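(* Let $G$ be an acyclic network with a source $S$, distinct destinations $T_1,\dots,T_N$ (all different from $S$), and a set of connections $\mathcal C=\mathcal C_d\cup\mathcal C_m$, where $\mathcal C_d=\{(S,T_i,\mathcal X(S,T_i)) : i\in[1,K]\}$ with $\mathcal X(S,T_i)\cap\mathcal X(S,T_j)=\emptyset$ for $i\ne j$, $i,j\in[1,K]$, is a set of disjoint multicast connections, and $\mathcal C_m=\{(S,T_i,\mathcal X(S)) : i\in[K+1,N]\}$ is a set of single source multicast connections. Then $(G,\mathcal C)$ is solvable if and only if the min-cut between $S$ and any (nonempty) $\mathcal T'\subseteq\{T_1,\dots,T_K\}$ is at least $\sum_{T_i\in\mathcal T'}|\mathcal X(S,T_i)|$, and the min-cut between $S$ and $T_j$ is at least $|\mathcal X(S)|$ for every $j\in[K+1,N]$.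
   Context: Network. $G=(\mathcal V,\mathcal E)$ consists of a finite set $\mathcal V$ of nodes; each node $V$ has a finite set $I(V)$ of input ports and a finite set $O(V)$ of output ports (all pairwise disjoint). Each edge in $\mathcal E$ is an ordered pair $(e_1,e_2)$ with $e_1\in O(V_1)$ and $e_2\in I(V_2)$ for some $V_1,V_2\in\mathcal V$. $G$ is acyclic if the directed graph on $\mathcal V$ with an arc $V_1\to V_2$ whenever some edge goes from $O(V_1)$ to $I(V_2)$ has no directed cycle. Linear transmission over a finite field. The source $S$ has independent symbols $\mathcal X(S)=[X(S,1),\dots,X(S,\mu(S))]$, $\mu(S)=|\mathcal X(S)|\le|O(S)|$, and $\mathcal X(S,T_i)\subseteq\mathcal X(S)$ is the set of processes demanded by $T_i$. $Y(e)$ denotes the symbol at port $e$. For $e\in O(V)$: $Y(e)=\sum_{e'\in I(V)}\beta_{(e',e)}Y(e')$, plus $\sum_i\alpha_{(i,e)}X(S,i)$ if $V=S$. For an input port $e'$: $Y(e')=\sum_{(e,e')\in\mathcal E}Y(e)$. A destination $T$ forms $Z(T,k)=\sum_{e'\in I(T)}\epsilon_{(e',(T,k))}Y(e')$, $1\le k\le\nu(T)$. The coefficients $\alpha,\beta,\epsilon$ are free. A connection $(S,T,\mathcal X(S,T))$ is established if the processes of $\mathcal X(S,T)$ are among the components of $\mathcal Z(T)=[Z(T,1),\dots,Z(T,\nu(T))]$, for all values of the source symbols. Solvability and field size. A base finite field $\mathbb F_q$ is given; the field size is not restricted, so $(G,\mathcal C)$ is called solvable if for some finite extension field of $\mathbb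 F_q$ (with symbols, coefficients and additions in it) the coefficients can be chosen so that all connections in $\mathcal C$ are established simultaneously. Min-cut. The min-cut between $S$ and a set $\mathcal T'$ of nodes (or a single node) is $\min_\Omega\operatorname{rank}(G_\Omega)$ over all $\Omega\subseteq\mathcal V$ with $S\in\Omega$ and $\mathcal T'\subseteq\Omega^c$, where $G_\Omega$ is the $0$-$1$ matrix over $\mathbb F_q$ with rows the output ports of nodes in $\Omega$, columns the input ports of nodes in $\Omega^c$, and entry $1$ exactly when there is an edge from the row port to the column port. *)

theory Defs
  imports "HOL-Algebra.Algebraic_Closure_Type" "HOL-Library.Function_Algebras"
    "HOL-Library.FuncSet"
begin

record ('v, 'p) network =
  nodes :: "'v set"
  inports :: "'v \<Rightarrow> 'p set"
  outports :: "'v \<Rightarrow> 'p set"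
  edges :: "('p \<times> 'p) set"

definition is_network :: "('v, 'p) network \<Rightarrow> bool" where
  "is_network G \<longleftrightarrow>
     finite (nodes G) \<and>
     (\<forall>V\<in>nodes G. finite (inports G V) \<and> finite (outports G V)) \<and>
     (\<forall>V\<in>nodes G. \<forall>W\<in>nodes G. inports G V \<inter> outports G W = {}) \<and>
     (\<forall>V\<in>nodes G. \<forall>W\<in>nodes G. V \<noteq> W \<longrightarrow>
        inports G V \<inter> inports G W = {} \<and> outports G V \<inter> outports G W = {}) \<and>
     edges G \<subseteq> (\<Union>V\<in>nodes G. outports G V) \<times> (\<Union>V\<in>nodes G. inports G V)"

definition arcs :: "('v, 'p) network \<Rightarrow> ('v \<times> 'v) set" where
  "arcs G = {(V, W). V \<in> nodes G \<and> W \<in> nodes G \<and>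
     (\<exists>e\<in>outports G V. \<exists>e'\<in>inports G W. (e, e') \<in> edges G)}"

definition acyclic_network :: "('v, 'p) network \<Rightarrow> bool" where
  "acyclic_network G \<longleftrightarrow> acyclic (arcs G)"

text \<open>
  The source processes $X(S,1), \ldots, X(S,\mu)$ are identified with their indices
  $1, \ldots, \mu$; \<open>x i\<close> is the value of the \<open>i\<close>-th one and \<open>y e\<close> the symbol at port \<open>e\<close>.
\<close>

definition transmission ::
  "('v, 'p) network \<Rightarrow> 'v \<Rightarrow> nat \<Rightarrow> (nat \<Rightarrow> 'p \<Rightarrow> 'k::field) \<Rightarrow> ('p \<Rightarrow> 'p \<Rightarrow> 'k)
     \<Rightarrow> (nat \<Rightarrow> 'k) \<Rightarrow> ('p \<Rightarrow> 'k) \<Rightarrow> bool" where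
  "transmission G S \<mu> \<alpha> \<beta> x y \<longleftrightarrow>
     (\<forall>V\<in>nodes G. \<forall>e\<in>outports G V.
        y e = (\<Sum>e'\<in>inports G V. \<beta> e' e * y e') + (if V = S then \<Sum>i=1..\<mu>. \<alpha> i e * x i else 0)) \<and>
     (\<forall>V\<in>nodes G. \<forall>e'\<in>inports G V. y e' = (\<Sum>e | (e, e') \<in> edges G. y e))"

definition received ::
  "('v, 'p) network \<Rightarrow> ('p \<Rightarrow> 'v \<Rightarrow> nat \<Rightarrow> 'k::field) \<Rightarrow> ('p \<Rightarrow> 'k) \<Rightarrow> 'v \<Rightarrow> nat \<Rightarrow> 'k" where
  "received G \<epsilon> y T k = (\<Sum>e'\<in>inports G T. \<epsilon> e' T k * y e')"

text \<open>
  Finite extension fields of the finite field \<open>'f\<close>, up to isomorphism over \<open>'f\<close>: since every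
  algebraic extension of \<open>'f\<close> embeds into its algebraic closure, these are the finite subfields
  of the closure that contain (the image of) \<open>'f\<close>.
\<close>

definition finite_extension_field :: "'f::field alg_closure set \<Rightarrow> bool" where
  "finite_extension_field L \<longleftrightarrow>
     finite L \<and> subfield L (ring_of_type_algebra :: 'f alg_closure ring) \<and> range to_ac \<subseteq> L"

text \<open>
  The source \<open>S\<close> being fixed, a connection $(S, T, D)$ is given by the pair \<open>(T, D)\<close>, where
  \<open>D\<close> is the set of indices of the demanded processes.  The family \<open>y\<close> of port symbols is a
  function of the tuple \<open>x\<close> of source symbols; in an acyclic network the equations
  \<open>transmission\<close> determine it uniquely on the ports (see \<open>transmission_unique\<close> below), so
  \<open>y\<close> is not a further degree of freedom.  The index \<open>k\<close> of the
  component of $\mathcal{Z}(T)$ carrying a demanded process must not depend on \<open>x\<close>.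
\<close>

definition solvable ::
  "'f::field itself \<Rightarrow> ('v, 'p) network \<Rightarrow> 'v \<Rightarrow> nat \<Rightarrow> ('v \<times> nat set) set \<Rightarrow> bool" where
  "solvable _ G S \<mu> C \<longleftrightarrow>
     (\<exists>L :: 'f alg_closure set. finite_extension_field L \<and>
       (\<exists>\<alpha> \<beta> \<epsilon> \<nu> y.
          (\<forall>i e. \<alpha> i e \<in> L) \<and> (\<forall>e' e. \<beta> e' e \<in> L) \<and> (\<forall>e' T k. \<epsilon> e' T k \<in> L) \<and>
          (\<forall>x \<in> {1..\<mu>} \<rightarrow>\<^sub>E L. transmission G S \<mu> \<alpha> \<beta> x (y x)) \<and>
          (\<forall>(T, D) \<in> C. \<forall>j\<in>D. \<exists>k\<in>{1..\<nu> T}. \<forall>x \<in> {1..\<mu>} \<rightarrow>\<^sub>E L.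
             received G \<epsilon> (y x) T k = x j)))"

definition cut_matrix ::
  "('v, 'p) network \<Rightarrow> 'v set \<Rightarrow> 'p \<Rightarrow> 'p \<Rightarrow> 'f::field" where
  "cut_matrix G \<Omega> e e' =
     (if e \<in> (\<Union>V\<in>\<Omega>. outports G V) \<and> e' \<in> (\<Union>V\<in>nodes G - \<Omega>. inports G V) \<and> (e, e') \<in> edges G
      then 1 else 0)"

text \<open>
  The rank is the dimension of the row space.  Rows are extended by \<open>0\<close> outside the column
  index set, which does not affect it.
\<close>

definition cut_rank :: "'f::field itself \<Rightarrow> ('v, 'p) network \<Rightarrow> 'v set \<Rightarrow> nat" where
  "cut_rank _ G \<Omega> =
     vector_space.dim (\<lambda>(c::'f) (r :: 'p \<Rightarrow> 'f) e'. c * r e')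
       (cut_matrix G \<Omega> ` (\<Union>V\<in>\<Omega>. outports G V))"

definition min_cut :: "'f::field itself \<Rightarrow> ('v, 'p) network \<Rightarrow> 'v \<Rightarrow> 'v set \<Rightarrow> nat" where
  "min_cut F G S \<T> = Min (cut_rank F G ` {\<Omega>. \<Omega> \<subseteq> nodes G \<and> S \<in> \<Omega> \<and> \<T> \<subseteq> nodes G - \<Omega>})"

lemma transmission_unique:
  assumes G: "is_network G" "acyclic_network G"
    and y: "transmission G S \<mu> \<alpha> \<beta> x y" and z: "transmission G S \<mu> \<alpha> \<beta> x z"
    and V: "V \<in> nodes G"
  shows "\<forall>e \<in> inports G V \<union> outports G V. y e = z e"
proof -
  have "arcs G \<subseteq> nodes G \<times> nodes G" by (auto simp: arcs_def)
  then have "finite (arcs G)"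
    using G(1) by (meson finite_SigmaI finite_subset is_network_def)
  then have "wf (arcs G)"
    using G(2) finite_acyclic_wf by (auto simp: acyclic_network_def)
  then show ?thesis using V
  proof (induction V rule: wf_induct_rule)
    case (less V)
    have eq_in: "y e' = z e'" if e': "e' \<in> inports G V" for e'
    proof -
      have "y e = z e" if e: "(e, e') \<in> edges G" for e
      proof -
        obtain W where W: "W \<in> nodes G" "e \<in> outports G W"
          using e G(1) unfolding is_network_def by blast
        then have "(W, V) \<in> arcs G"
          using e e' less.prems by (auto simp: arcs_def)
        then show ?thesis using less.IH W by blast
      qed
      then show ?thesis
        using y z e' less.prems unfolding transmission_def by (auto intro!: sum.cong)
    qed
    moreover have "y e = z e" if "e \<in> outports G V" for e
      using y z that less.prems eq_in unfolding transmission_def by (auto intro!: sum.cong)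
    ultimately show ?case by blast
  qed
qed

end

theory Submission
  imports Defs
begin

text \<open>
  Necessity: the inputs of the nodes outside a cut \<open>\<Omega>\<close> are determined by a vector in
  the row space of the cut matrix, so over a field with \<open>q\<close> elements they take at most
  \<open>q\<close> to the power of the cut rank values.

  Sufficiency: draw all coefficients uniformly from a large finite extension field.  Fix a nonzero
  source vector and let \<open>\<Omega>\<close> consist of the source and the nodes with a nonzero input.  The
  joint output \<open>z\<close> of \<open>\<Omega>\<close> lies in the left kernel of the cut matrix; for each such
  \<open>z\<close> the equations at the output ports of \<open>\<Omega>\<close> involve disjoint sets of coefficients, so
  they hold for a \<open>1/q\<close> fraction each, and so do the equations saying that a destination in
  \<open>\<Omega>\<close> receives only zeros.  The cut condition then bounds the probability that all
  destinations receive zero by \<open>2\<^sup>n q\<^sup>-\<^sup>d\<close>, where \<open>d\<close> is the total demand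
  and \<open>n\<close> the number of nodes.  There are fewer than
  \<open>q\<^sup>d / (q - 1)\<close> lines of source vectors supported on the demanded processes, so for
  large \<open>q\<close> the transfer matrices to the disjoint multicast destinations jointly and to each full
  multicast destination separately are invertible.  Precoding at the source makes the
  joint transfer matrix the identity; the full multicast destinations invert their own.
\<close>

subsection \<open>Finite subfields of the algebraic closure\<close>

text \<open>Translates the record-based notion into closure under the class operations. Inverting 0
  is harmless because \<open>inverse 0 = 0\<close>.\<close>

lemma subfield_type_algebra_iff:
  fixes L :: "'a::field set"
  shows "subfield L (ring_of_type_algebra :: 'a ring) \<longleftrightarrow>
    0 \<in> L \<and> 1 \<in> L \<and> (\<forall>x\<in>L. \<forall>y\<in>L. x + y \<in> L) \<and> (\<forall>x\<in>L. - x \<in> L) \<and>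
    (\<forall>x\<in>L. \<forall>y\<in>L. x * y \<in> L) \<and> (\<forall>x\<in>L. inverse x \<in> L)"
proof -
  let ?R = "ring_of_type_algebra :: 'a ring"
  interpret R: field ?R by (rule field_from_type_algebra)
  have ops: "x \<otimes>\<^bsub>?R\<^esub> y = x * y" "x \<oplus>\<^bsub>?R\<^esub> y = x + y" "\<one>\<^bsub>?R\<^esub> = 1" "\<zero>\<^bsub>?R\<^esub> = 0"
    "carrier ?R = UNIV" for x y
    by (simp_all add: ring_of_type_algebra_def)
  have minus: "\<ominus>\<^bsub>?R\<^esub> x = - x" for x
    by (rule R.minus_equality) (simp_all add: ops)
  have inv: "inv\<^bsub>?R\<^esub> x = inverse x" if "x \<noteq> 0" for x
    by (rule R.comm_inv_char) (use that in \<open>simp_all add: ops\<close>)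
  show ?thesis
  proof
    assume L: "subfield L ?R"
    note sub = subringE[OF subfieldE(1)[OF L]]
    have "inverse x \<in> L" if "x \<in> L" for x
      using R.subfield_m_inv(1)[OF L, of x] that sub(2) inv by (cases "x = 0") (auto simp: ops)
    then show "0 \<in> L \<and> 1 \<in> L \<and> (\<forall>x\<in>L. \<forall>y\<in>L. x + y \<in> L) \<and> (\<forall>x\<in>L. - x \<in> L) \<and>
        (\<forall>x\<in>L. \<forall>y\<in>L. x * y \<in> L) \<and> (\<forall>x\<in>L. inverse x \<in> L)"
      using sub by (auto simp: ops minus)
  next
    assume L: "0 \<in> L \<and> 1 \<in> L \<and> (\<forall>x\<in>L. \<forall>y\<in>L. x + y \<in> L) \<and> (\<forall>x\<in>L. - x \<in> L) \<and>
        (\<forall>x\<in>L. \<forall>y\<in>L. x * y \<in> L) \<and> (\<forall>x\<in>L. inverse x \<in> L)"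
    show "subfield L ?R"
      by (rule R.subfieldI', rule R.subringI) (use L in \<open>auto simp: ops minus inv\<close>)
  qed
qed

text \<open>When \<open>n\<close> vanishes in the field, the polynomial X^n - X has derivative -1,
  so no root is multiple; over an algebraically closed field it therefore has exactly
  \<open>n\<close> distinct roots.\<close>

lemma card_power_fixpoints:
  fixes n :: nat
  assumes "of_nat n = (0 :: 'a::alg_closed_field)" and "n > 1"
  shows "card {x::'a. x ^ n = x} = n"
proof -
  define p :: "'a poly" where "p = monom 1 n - monom 1 1"
  have deg: "degree p = n"
    unfolding p_def diff_conv_add_uminus using assms(2)
    by (subst degree_add_eq_left) (simp_all add: degree_monom_eq)
  have "p \<noteq> 0" using deg assms(2) by auto
  have roots: "{x. poly p x = 0} = {x. x ^ n = x}"
    by (simp add: p_def poly_monom)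
  have der: "poly (pderiv p) x = -1" for x
    by (simp add: p_def pderiv_diff pderiv_monom poly_monom assms(1))
  obtain A where A: "size A = degree p" "p = smult (lead_coeff p) (\<Prod>x\<in>#A. [:-x, 1:])"
    using alg_closed_imp_factorization[OF \<open>p \<noteq> 0\<close>] by blast
  have "count A x \<le> 1" for x
  proof (rule ccontr)
    assume "\<not> count A x \<le> 1"
    then have "{#x, x#} \<subseteq># A" by (simp add: subseteq_mset_def)
    then obtain B where "A = {#x, x#} + B" by (metis subset_mset.le_iff_add)
    then have "p = [:-x, 1:] * ([:-x, 1:] * smult (lead_coeff p) (\<Prod>x\<in>#B. [:-x, 1:]))"
      using A(2) by (simp add: mult.assoc)
    then have "poly (pderiv p) x = poly (pderiv ([:-x, 1:] *
        ([:-x, 1:] * smult (lead_coeff p) (\<Prod>x\<in>#B. [:-x, 1:])))) x" by metis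
    also have "\<dots> = 0" unfolding pderiv_mult poly_add poly_mult by simp
    finally show False using der[of x] by simp
  qed
  then have "A = mset_set (set_mset A)"
    by (intro multiset_eqI) (metis count_eq_zero_iff count_greater_zero_iff count_mset_set(1,3)
        finite_set_mset le_neq_implies_less less_one)
  then have "size A = card (set_mset A)" by (metis size_mset_set)
  moreover have "set_mset A = {x. poly p x = 0}"
    using \<open>p \<noteq> 0\<close> by (subst A(2)) (auto simp: poly_prod_mset prod_mset_zero_iff)
  ultimately show ?thesis using A(1) deg roots by simp
qed

text \<open>\<open>L\<close> is the fixed set of the map x -> x^Q for a power \<open>Q\<close> of
  the characteristic: the freshman's dream makes it a field, and it has \<open>Q\<close> elements.
  The map must also fix the image of \<open>'f\<close>; a suitable \<open>Q\<close> exists because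
  the Frobenius map permutes the finite field \<open>'f\<close> and so has finite order.\<close>

lemma ex_finite_extension_field:
  fixes b :: nat
  shows "\<exists>L :: 'f::{finite,field} alg_closure set. finite_extension_field L \<and> b < card L"
proof -
  let ?p = "CHAR('f)"
  have p: "prime ?p"
    using prime_CHAR_semidom[where ?'a='f] finite_imp_CHAR_pos[where ?'a='f] by simp
  then have pa: "prime CHAR('f alg_closure)" by simp
  define F :: "'f \<Rightarrow> 'f" where "F x = x ^ ?p" for x
  have F_iter: "(F ^^ m) x = x ^ (?p ^ m)" for m x
    by (induction m) (simp_all add: F_def power_mult[symmetric] mult.commute)
  have "inj F"
  proof (rule injI)
    fix x y assume "F x = F y"
    moreover have "F ((x - y) + y) = F (x - y) + F y"
      unfolding F_def by (rule freshmans_dream) (use p in auto)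
    ultimately have "F (x - y) = 0" by simp
    then show "x = y" by (simp add: F_def)
  qed
  \<comment> \<open>There are only finitely many self-maps of \<open>'f\<close>, so two iterates of
    \<open>F\<close> agree; injectivity cancels the shorter one.\<close>
  have "\<exists>m>0. F ^^ m = id"
  proof -
    have "finite (range (\<lambda>m. F ^^ m))" by (rule finite_subset[OF subset_UNIV]) simp
    then have "\<not> inj (\<lambda>m::nat. F ^^ m)" using finite_imageD by blast
    then obtain m n where mn: "F ^^ m = F ^^ n" "m < n"
      unfolding inj_def by (metis linorder_neqE_nat)
    have "F ^^ n = F ^^ m \<circ> F ^^ (n - m)"
      using mn(2) by (metis funpow_add le_add_diff_inverse less_imp_le)
    then have "F ^^ m \<circ> F ^^ (n - m) = F ^^ m \<circ> id" using mn(1) by simp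
    then have "(F ^^ m) ((F ^^ (n - m)) x) = (F ^^ m) x" for x by (metis comp_apply id_apply)
    then have "F ^^ (n - m) = id" using inj_fn[OF \<open>inj F\<close>, of m] by (simp add: fun_eq_iff inj_eq)
    then show ?thesis using mn(2) by (intro exI[of _ "n - m"]) simp
  qed
  then obtain m where m: "m > 0" "F ^^ m = id" by blast
  \<comment> \<open>Being a multiple of \<open>m\<close> makes the \<open>Q\<close>-th power trivial
    on \<open>'f\<close>; the factor \<open>Suc b\<close> gives \<open>Q > k > b\<close>.\<close>
  define k where "k = m * Suc b"
  define Q where "Q = ?p ^ k"
  have k: "k > b" using m(1) unfolding k_def by (metis Suc_le_eq mult_le_mono1 mult_1 One_nat_def)
  have "Q > k" unfolding Q_def using p by (intro power_gt_expt) (auto simp: prime_gt_Suc_0_nat)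
  then have Q: "Q > 1" "Q > b" using k by auto
  have dvd: "?p dvd Q" using k unfolding Q_def by (simp add: dvd_power)
  define L :: "'f alg_closure set" where "L = {x. x ^ Q = x}"
  have fr: "(x + y) ^ Q = x ^ Q + y ^ Q" for x y :: "'f alg_closure"
    by (rule freshmans_dream'[OF pa]) (simp add: Q_def)
  have "of_nat Q = (0 :: 'f alg_closure)"
    using dvd by (simp add: of_nat_eq_0_iff_char_dvd)
  then have card: "card L = Q" unfolding L_def by (rule card_power_fixpoints) (use Q in simp)
  have "finite L" using card Q by (metis card.infinite not_less_zero)
  \<comment> \<open>Additivity of the \<open>Q\<close>-th power at \<open>x\<close> and
    \<open>- x\<close> spares a case distinction on the parity of \<open>Q\<close>.\<close>
  moreover have "- x \<in> L" if "x \<in> L" for x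
  proof -
    have "0 = x + (- x) ^ Q" using fr[of x "-x"] that Q(1) by (simp add: L_def zero_power)
    then show ?thesis using minus_unique[of x "(- x) ^ Q"] by (simp add: L_def)
  qed
  then have "subfield L (ring_of_type_algebra :: 'f alg_closure ring)"
    unfolding subfield_type_algebra_iff using Q(1) fr
    by (auto simp: L_def power_mult_distrib power_inverse)
  moreover have "range to_ac \<subseteq> L"
  proof -
    have "F ^^ k = id" unfolding k_def funpow_mult[symmetric] m(2) by simp
    then have "x ^ Q = x" for x :: 'f by (metis F_iter Q_def id_apply)
    then show ?thesis by (auto simp: L_def simp flip: to_ac_power)
  qed
  ultimately show ?thesis using card Q unfolding finite_extension_field_def by blast
qed

subsection \<open>Linear systems over a finite extension field\<close>

text \<open>The extension is a finite subset \<open>L\<close> of an ambient field, with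
  \<open>h\<close> embedding the base field, since its size is chosen inside a proof and a type
  could not depend on that choice.\<close>

locale finite_extension =
  fixes L :: "'k::field set" and h :: "'f::field \<Rightarrow> 'k"
  assumes finite_L: "finite L"
    and zero_L: "0 \<in> L" and one_L: "1 \<in> L"
    and add_L: "\<And>x y. x \<in> L \<Longrightarrow> y \<in> L \<Longrightarrow> x + y \<in> L"
    and uminus_L: "\<And>x. x \<in> L \<Longrightarrow> - x \<in> L"
    and mult_L: "\<And>x y. x \<in> L \<Longrightarrow> y \<in> L \<Longrightarrow> x * y \<in> L"
    and h_L: "\<And>a. h a \<in> L"
    and h_0: "h 0 = 0" and h_1: "h 1 = 1"
    and h_add: "\<And>a b. h (a + b) = h a + h b"
    and h_mult: "\<And>a b. h (a * b) = h a * h b"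
begin

abbreviation q :: nat where "q \<equiv> card L"

lemma q_pos: "q > 0"
  using finite_L zero_L by (auto simp: card_gt_0_iff)

lemma sum_L: "(\<And>a. a \<in> A \<Longrightarrow> f a \<in> L) \<Longrightarrow> sum f A \<in> L"
  by (induction A rule: infinite_finite_induct) (auto intro: zero_L add_L)

lemma diff_L: "x \<in> L \<Longrightarrow> y \<in> L \<Longrightarrow> x - y \<in> L"
  by (metis add_L diff_conv_add_uminus uminus_L)

lemma h_sum: "h (sum f A) = (\<Sum>a\<in>A. h (f a))"
  by (induction A rule: infinite_finite_induct) (auto simp: h_0 h_add)

end

lemma sum_fun_apply: "(\<Sum>a\<in>A. f a) j = (\<Sum>a\<in>A. f a j)"
  by (induction A rule: infinite_finite_induct) auto

section \<open>Rank over the base field and counting over the extension\<close>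

text \<open>A basis \<open>B\<close> is chosen among the vectors themselves. The dual functional of
  \<open>b0\<close> extends to a linear functional on the whole space; since the vectors are
  supported on the finite set \<open>J\<close>, it is evaluation against its values \<open>g\<close>
  at the unit vectors. Both the expansion coefficients and \<open>g\<close> lie in the base field,
  so \<open>h\<close> carries the identities over to the extension.\<close>

lemma ex_basis_with_coordinates:
  fixes A :: "('p \<Rightarrow> 'f::field) set"
  assumes "finite A" "finite J" and supp: "\<forall>v\<in>A. \<forall>j. j \<notin> J \<longrightarrow> v j = 0"
  shows "\<exists>B\<subseteq>A. card B = vector_space.dim (\<lambda>(c::'f) (r::'p \<Rightarrow> 'f) j. c * r j) A \<and>
    (\<forall>v\<in>A. \<exists>a. \<forall>j. v j = (\<Sum>b\<in>B. a b * b j)) \<and>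
    (\<forall>b0\<in>B. \<exists>g. \<forall>b\<in>B. (\<Sum>j\<in>J. b j * g j) = (if b = b0 then 1 else 0))"
proof -
  interpret fun_vs: vector_space "\<lambda>(c::'f) (r::'p \<Rightarrow> 'f) j. c * r j"
    by unfold_locales (auto simp: fun_eq_iff algebra_simps)
  interpret scalar_vs: vector_space "(*) :: 'f \<Rightarrow> 'f \<Rightarrow> 'f"
    by unfold_locales (auto simp: algebra_simps)
  interpret pair: vector_space_pair "\<lambda>(c::'f) (r::'p \<Rightarrow> 'f) j. c * r j" "(*)"
    by unfold_locales
  obtain B where B: "B \<subseteq> A" "fun_vs.independent B" "A \<subseteq> fun_vs.span B" "card B = fun_vs.dim A"
    using fun_vs.basis_exists by blast
  have finB: "finite B" using B(1) assms(1) finite_subset by blast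
  have "\<exists>a. \<forall>j. v j = (\<Sum>b\<in>B. a b * b j)" if "v \<in> A" for v
  proof -
    have "v \<in> fun_vs.span B" using that B(3) by blast
    then obtain a where "v = (\<Sum>b\<in>B. (\<lambda>j. a b * b j))"
      unfolding fun_vs.span_finite[OF finB] by blast
    then show ?thesis by (auto simp only: sum_fun_apply)
  qed
  moreover have "\<exists>g. \<forall>b\<in>B. (\<Sum>j\<in>J. b j * g j) = (if b = b0 then 1 else 0)" if "b0 \<in> B" for b0
  proof -
    obtain f where f: "Vector_Spaces.linear (\<lambda>(c::'f) (r::'p \<Rightarrow> 'f) j. c * r j) (*) f"
      "\<forall>b\<in>B. f b = (if b = b0 then 1 else 0)"
      using pair.linear_independent_extend[OF B(2), of "\<lambda>b. if b = b0 then 1 else 0"] by blast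
    interpret f: Vector_Spaces.linear "\<lambda>(c::'f) (r::'p \<Rightarrow> 'f) j. c * r j" "(*)" f by (rule f(1))
    define d :: "'p \<Rightarrow> 'p \<Rightarrow> 'f" where "d j = (\<lambda>j'. if j' = j then 1 else 0)" for j
    have "f b = (\<Sum>j\<in>J. b j * f (d j))" if "b \<in> B" for b
    proof -
      have "b = (\<Sum>j\<in>J. (\<lambda>j'. b j * d j j'))"
      proof
        fix j'
        have "(\<Sum>j\<in>J. b j * d j j') = (\<Sum>j\<in>J. if j = j' then b j' else 0)"
          by (intro sum.cong) (auto simp: d_def)
        also have "\<dots> = b j'" using supp that B(1) assms(2) by auto
        finally show "b j' = (\<Sum>j\<in>J. (\<lambda>j'. b j * d j j')) j'" by (simp only: sum_fun_apply)
      qed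
      then have "f b = f (\<Sum>j\<in>J. (\<lambda>j'. b j * d j j'))" by (rule arg_cong)
      also have "\<dots> = (\<Sum>j\<in>J. b j * f (d j))" by (simp only: f.sum f.scale)
      finally show ?thesis .
    qed
    then show ?thesis using f(2) by (intro exI[of _ "\<lambda>j. f (d j)"]) simp
  qed
  ultimately show ?thesis using B(1,4) by blast
qed

context finite_extension
begin

abbreviation matrix_rank :: "('i \<Rightarrow> 'p \<Rightarrow> 'f) \<Rightarrow> 'i set \<Rightarrow> nat" where
  "matrix_rank M I \<equiv> vector_space.dim (\<lambda>(c::'f) (r::'p \<Rightarrow> 'f) j. c * r j) (M ` I)"

text \<open>Every row is a combination of \<open>matrix_rank M I\<close> basis rows with
  coefficients in the base field. Applying \<open>h\<close> to these coefficients rewrites each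
  \<open>L\<close>-combination of rows as an \<open>L\<close>-combination of the basis rows
  alone.\<close>

lemma card_row_space_le:
  fixes M :: "'i \<Rightarrow> 'p \<Rightarrow> 'f"
  assumes "finite I" "finite J" and supp: "\<And>i j. i \<in> I \<Longrightarrow> j \<notin> J \<Longrightarrow> M i j = 0"
  shows "card ((\<lambda>z j. \<Sum>i\<in>I. z i * h (M i j)) ` (I \<rightarrow>\<^sub>E L)) \<le> q ^ matrix_rank M I"
proof -
  have supp': "\<forall>v\<in>M ` I. \<forall>j. j \<notin> J \<longrightarrow> v j = 0" using supp by blast
  obtain B where B: "B \<subseteq> M ` I" "card B = matrix_rank M I"
    "\<forall>v\<in>M ` I. \<exists>a. \<forall>j. v j = (\<Sum>b\<in>B. a b * b j)"
    using ex_basis_with_coordinates[OF finite_imageI[OF assms(1)] assms(2) supp'] by blast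
  have finB: "finite B" using B(1) assms(1) by (auto intro: finite_surj)
  have "\<forall>i\<in>I. \<exists>a. \<forall>j. M i j = (\<Sum>b\<in>B. a b * b j)" using B(3) by blast
  from bchoice[OF this]
  obtain a where a: "\<And>i j. i \<in> I \<Longrightarrow> M i j = (\<Sum>b\<in>B. a i b * b j)" by blast
  have M: "h (M i j) = (\<Sum>b\<in>B. h (a i b) * h (b j))" if "i \<in> I" for i j
    by (simp add: a[OF that] h_sum h_mult)
  have "(\<lambda>z j. \<Sum>i\<in>I. z i * h (M i j)) ` (I \<rightarrow>\<^sub>E L) \<subseteq>
    (\<lambda>u j. \<Sum>b\<in>B. u b * h (b j)) ` (B \<rightarrow>\<^sub>E L)"
  proof (rule image_subsetI)
    fix z assume z: "z \<in> I \<rightarrow>\<^sub>E L"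
    define u where "u = (\<lambda>b\<in>B. \<Sum>i\<in>I. z i * h (a i b))"
    have "u \<in> B \<rightarrow>\<^sub>E L" using z unfolding u_def by (auto intro!: sum_L mult_L h_L)
    moreover have "(\<lambda>j. \<Sum>i\<in>I. z i * h (M i j)) = (\<lambda>j. \<Sum>b\<in>B. u b * h (b j))"
    proof
      fix j
      have "(\<Sum>i\<in>I. z i * h (M i j)) = (\<Sum>i\<in>I. \<Sum>b\<in>B. z i * h (a i b) * h (b j))"
        by (simp add: M sum_distrib_left mult.assoc)
      also have "\<dots> = (\<Sum>b\<in>B. u b * h (b j))"
        by (subst sum.swap) (simp add: u_def sum_distrib_right)
      finally show "(\<Sum>i\<in>I. z i * h (M i j)) = (\<Sum>b\<in>B. u b * h (b j))" .
    qed
    ultimately show "(\<lambda>j. \<Sum>i\<in>I. z i * h (M i j)) \<in>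
      (\<lambda>u j. \<Sum>b\<in>B. u b * h (b j)) ` (B \<rightarrow>\<^sub>E L)" by blast
  qed
  moreover have fin: "finite (B \<rightarrow>\<^sub>E L)" using finB finite_L by (simp add: finite_PiE)
  ultimately have "card ((\<lambda>z j. \<Sum>i\<in>I. z i * h (M i j)) ` (I \<rightarrow>\<^sub>E L)) \<le> card (B \<rightarrow>\<^sub>E L)"
    by (meson card_image_le card_mono finite_imageI le_trans)
  then show ?thesis using finB B(2) by (simp add: card_funcsetE)
qed

text \<open>A coordinate functional on a basis of the row space is a combination of columns over the
  base field, so rows independent over the base field stay independent over the extension.\<close>
lemma card_left_kernel_le:
  fixes M :: "'i \<Rightarrow> 'p \<Rightarrow> 'f"
  assumes "finite I" "finite J" and supp: "\<And>i j. i \<in> I \<Longrightarrow> j \<notin> J \<Longrightarrow> M i j = 0"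
  shows "card {z \<in> I \<rightarrow>\<^sub>E L. \<forall>j\<in>J. (\<Sum>i\<in>I. z i * h (M i j)) = 0} * q ^ matrix_rank M I \<le> q ^ card I"
proof -
  let ?W = "{z \<in> I \<rightarrow>\<^sub>E L. \<forall>j\<in>J. (\<Sum>i\<in>I. z i * h (M i j)) = 0}"
  have supp': "\<forall>v\<in>M ` I. \<forall>j. j \<notin> J \<longrightarrow> v j = 0" using supp by blast
  obtain B where B: "B \<subseteq> M ` I" "card B = matrix_rank M I"
    "\<And>b0. b0 \<in> B \<Longrightarrow> \<exists>g. \<forall>b\<in>B. (\<Sum>j\<in>J. b j * g j) = (if b = b0 then 1 else 0)"
    using ex_basis_with_coordinates[OF finite_imageI[OF assms(1)] assms(2) supp'] by blast
  have finB: "finite B" using B(1) assms(1) by (auto intro: finite_surj)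
  \<comment> \<open>\<open>M\<close> may repeat rows, so \<open>s\<close> selects one index for each
    basis row; the coordinates at these indices will turn out to be the dependent ones.\<close>
  have "\<forall>b\<in>B. \<exists>i. i \<in> I \<and> M i = b" using B(1) by blast
  from bchoice[OF this]
  obtain s where s: "\<And>b. b \<in> B \<Longrightarrow> s b \<in> I \<and> M (s b) = b" by blast
  have inj_s: "inj_on s B" using s by (metis inj_onI)
  have card_s: "card (s ` B) = card B" by (rule card_image[OF inj_s])
  have s_sub: "s ` B \<subseteq> I" using s by auto
  \<comment> \<open>Combining the columns with the weights \<open>h (g j)\<close> isolates the
    coefficient of the basis row \<open>b0\<close>.\<close>
  have dual: "w (s b0) = 0"
    if w: "\<And>i. i \<in> I - s ` B \<Longrightarrow> w i = 0" "\<forall>j\<in>J. (\<Sum>i\<in>I. w i * h (M i j)) = 0"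
      and b0: "b0 \<in> B" for w b0
  proof -
    obtain g where g: "\<And>b. b \<in> B \<Longrightarrow> (\<Sum>j\<in>J. b j * g j) = (if b = b0 then 1 else 0)"
      using B(3)[OF b0] by blast
    have ws: "(\<Sum>i\<in>I. w i * h (M i j)) = (\<Sum>b\<in>B. w (s b) * h (b j))" for j
    proof -
      have "(\<Sum>i\<in>I. w i * h (M i j)) = (\<Sum>i\<in>s ` B. w i * h (M i j))"
        using w(1) s_sub by (intro sum.mono_neutral_right assms(1)) auto
      then show ?thesis using s by (simp add: sum.reindex[OF inj_s])
    qed
    have "0 = (\<Sum>j\<in>J. (\<Sum>b\<in>B. w (s b) * h (b j)) * h (g j))"
      using w(2) ws by simp
    also have "\<dots> = (\<Sum>b\<in>B. \<Sum>j\<in>J. w (s b) * (h (b j) * h (g j)))"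
      by (subst sum.swap) (simp add: sum_distrib_right mult.assoc)
    also have "\<dots> = (\<Sum>b\<in>B. w (s b) * h (\<Sum>j\<in>J. b j * g j))"
      by (simp add: sum_distrib_left h_sum h_mult)
    also have "\<dots> = (\<Sum>b\<in>B. if b = b0 then w (s b0) else 0)"
      by (intro sum.cong) (auto simp: g h_0 h_1)
    finally show ?thesis using b0 finB by simp
  qed
  \<comment> \<open>The difference of two kernel vectors that agree off \<open>s\<close>
    B\<open>is a kernel vector supported on\<close>s \<open>B\<close>, which vanishes by
    \<open>dual\<close>. Hence only \<open>card I - card B\<close> coordinates are free.\<close>
  have inj: "inj_on (\<lambda>z. restrict z (I - s ` B)) ?W"
  proof (rule inj_onI)
    fix z z' assume z: "z \<in> ?W" and z': "z' \<in> ?W"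
      and eq: "restrict z (I - s ` B) = restrict z' (I - s ` B)"
    have off: "z i = z' i" if "i \<in> I - s ` B" for i using eq that by (metis restrict_apply')
    have "\<forall>j\<in>J. (\<Sum>i\<in>I. (z i - z' i) * h (M i j)) = 0"
      using z z' by (simp add: left_diff_distrib sum_subtractf)
    then have "z (s b) - z' (s b) = 0" if "b \<in> B" for b
      using dual[of "\<lambda>i. z i - z' i" b] off that by simp
    then have "z i = z' i" if "i \<in> I" for i using off that by (cases "i \<in> s ` B") auto
    then show "z = z'" using z z' by (auto intro: PiE_ext)
  qed
  have fin: "finite ((I - s ` B) \<rightarrow>\<^sub>E L)" using assms(1) finite_L by (simp add: finite_PiE)
  have "(\<lambda>z. restrict z (I - s ` B)) ` ?W \<subseteq> (I - s ` B) \<rightarrow>\<^sub>E L"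
    by (rule image_subsetI) (auto simp: PiE_iff)
  then have "card ?W \<le> card ((I - s ` B) \<rightarrow>\<^sub>E L)"
    by (rule card_inj_on_le[OF inj _ fin])
  also have "\<dots> = q ^ (card I - card B)"
    using assms(1) s_sub finB by (simp add: card_funcsetE card_Diff_subset finite_subset card_s)
  finally have "card ?W * q ^ card B \<le> q ^ (card I - card B) * q ^ card B" by simp
  also have "\<dots> = q ^ card I"
    using card_mono[OF assms(1) s_sub] card_s by (simp flip: power_add)
  finally show ?thesis using B(2) by simp
qed

section \<open>Counting coefficient vectors that satisfy linear equations\<close>

text \<open>Since \<open>u i0\<close> is nonzero, the other coordinates determine
  \<open>v i0\<close>, so forgetting it is injective on the solutions. The bound is only an
  inequality because \<open>u\<close> and \<open>t\<close> take values in the ambient field and a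
  solution in \<open>L\<close> may fail to exist.\<close>

lemma card_linear_equation_le:
  assumes "finite I" "I' \<subseteq> I" and i0: "i0 \<in> I'" "u i0 \<noteq> 0"
  shows "card {v \<in> I \<rightarrow>\<^sub>E L. (\<Sum>i\<in>I'. v i * u i) = t} * q \<le> card (I \<rightarrow>\<^sub>E L)"
proof -
  let ?A = "{v \<in> I \<rightarrow>\<^sub>E L. (\<Sum>i\<in>I'. v i * u i) = t}"
  have finI': "finite I'" using assms finite_subset by blast
  have inj: "inj_on (\<lambda>v. restrict v (I - {i0})) ?A"
  proof (rule inj_onI)
    fix v v' assume v: "v \<in> ?A" and v': "v' \<in> ?A"
      and eq: "restrict v (I - {i0}) = restrict v' (I - {i0})"
    have off: "v i = v' i" if "i \<in> I" "i \<noteq> i0" for i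
      using eq that by (metis Diff_iff empty_iff insert_iff restrict_apply')
    have *: "(\<Sum>i\<in>I'. v i * u i) = (\<Sum>i\<in>I'. v' i * u i)" using v v' by simp
    have "v i0 * u i0 = v' i0 * u i0"
    proof -
      have "(\<Sum>i\<in>I' - {i0}. v i * u i) = (\<Sum>i\<in>I' - {i0}. v' i * u i)"
        using off assms(2) by (intro sum.cong) auto
      with * show ?thesis by (simp add: sum.remove[OF finI' i0(1)])
    qed
    then have "v i = v' i" if "i \<in> I" for i using off that i0(2) by auto
    then show "v = v'" using v v' by (auto intro: PiE_ext)
  qed
  have fin: "finite ((I - {i0}) \<rightarrow>\<^sub>E L)" using assms(1) finite_L by (simp add: finite_PiE)
  have "(\<lambda>v. restrict v (I - {i0})) ` ?A \<subseteq> (I - {i0}) \<rightarrow>\<^sub>E L"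
    by (rule image_subsetI) (auto simp: PiE_iff)
  then have "card ?A \<le> card ((I - {i0}) \<rightarrow>\<^sub>E L)" by (rule card_inj_on_le[OF inj _ fin])
  also have "\<dots> = q ^ card (I - {i0})" using assms(1) by (simp add: card_funcsetE)
  finally have "card ?A * q \<le> q ^ card (I - {i0}) * q" by simp
  also have "\<dots> = q ^ card I"
    using assms(1,2) i0(1) by (metis card_Suc_Diff1 power_Suc2 subsetD)
  finally show ?thesis using assms(1) by (simp add: card_funcsetE)
qed

text \<open>The equation at \<open>e\<close> involves only the row \<open>c e\<close>, so the
  solution set sits inside a product over \<open>E\<close>, and each factor with an equation shrinks
  by \<open>q\<close>. This is independence of the events, stated by counting.\<close>

lemma card_linear_equations_le:
  assumes "finite E" "finite I" "E' \<subseteq> E" "\<And>e. e \<in> E' \<Longrightarrow> I' e \<subseteq> I"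
    and "\<And>e. e \<in> E' \<Longrightarrow> \<exists>i\<in>I' e. u e i \<noteq> 0"
  shows "card {c \<in> E \<rightarrow>\<^sub>E (I \<rightarrow>\<^sub>E L). \<forall>e\<in>E'. (\<Sum>i\<in>I' e. c e i * u e i) = t e} * q ^ card E'
    \<le> card (E \<rightarrow>\<^sub>E (I \<rightarrow>\<^sub>E L))"
proof -
  define A where "A e = (if e \<in> E' then {v \<in> I \<rightarrow>\<^sub>E L. (\<Sum>i\<in>I' e. v i * u e i) = t e} else I \<rightarrow>\<^sub>E L)" for e
  have finA: "finite (A e)" for e
    unfolding A_def using assms(2) finite_L by (simp add: finite_PiE)
  have "{c \<in> E \<rightarrow>\<^sub>E (I \<rightarrow>\<^sub>E L). \<forall>e\<in>E'. (\<Sum>i\<in>I' e. c e i * u e i) = t e} \<subseteq> PiE E A"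
    by (auto simp: A_def PiE_iff extensional_def)
  then have "card {c \<in> E \<rightarrow>\<^sub>E (I \<rightarrow>\<^sub>E L). \<forall>e\<in>E'. (\<Sum>i\<in>I' e. c e i * u e i) = t e} * q ^ card E'
      \<le> card (PiE E A) * q ^ card E'"
    using assms(1) finA by (intro mult_right_mono card_mono finite_PiE) auto
  \<comment> \<open>The power of \<open>q\<close> is spread over all of \<open>E\<close> so that the
    comparison can be made factor by factor.\<close>
  also have "\<dots> = card (PiE E A) * (\<Prod>e\<in>E. if e \<in> E' then q else 1)"
    using assms(1,3) by (simp add: prod.If_cases Int_absorb1)
  also have "\<dots> = (\<Prod>e\<in>E. card (A e) * (if e \<in> E' then q else 1))"
    using assms(1) by (simp add: card_PiE prod.distrib)
  also have "\<dots> \<le> (\<Prod>e\<in>E. card (I \<rightarrow>\<^sub>E L))"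
  proof (rule prod_mono)
    fix e assume "e \<in> E"
    show "0 \<le> card (A e) * (if e \<in> E' then q else 1) \<and>
      card (A e) * (if e \<in> E' then q else 1) \<le> card (I \<rightarrow>\<^sub>E L)"
    proof (cases "e \<in> E'")
      case True
      then obtain i0 where "i0 \<in> I' e" "u e i0 \<noteq> 0" using assms(5) by blast
      then show ?thesis
        using card_linear_equation_le[OF assms(2) assms(4)[OF True], of i0 "u e" "t e"] True
        by (simp add: A_def)
    qed (simp add: A_def)
  qed
  also have "\<dots> = card (E \<rightarrow>\<^sub>E (I \<rightarrow>\<^sub>E L))" using assms(1) by (simp add: card_PiE)
  finally show ?thesis .
qed

end

subsection \<open>Transmissions and cuts\<close>

locale coded_network = finite_extension L h
  for L :: "'k::field set" and h :: "'f::field \<Rightarrow> 'k" +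
  fixes G :: "('v, 'p) network" and S :: 'v and \<mu> :: nat
  assumes network: "is_network G" and acyc: "acyclic_network G" and S: "S \<in> nodes G"
begin

definition outs :: "'v set \<Rightarrow> 'p set" where "outs \<Omega> = (\<Union>V\<in>\<Omega>. outports G V)"
definition ins :: "'v set \<Rightarrow> 'p set" where "ins \<Omega> = (\<Union>V\<in>\<Omega>. inports G V)"
definition owner :: "'p \<Rightarrow> 'v" where "owner e = (THE V. V \<in> nodes G \<and> e \<in> outports G V)"

lemma finite_nodes: "finite (nodes G)"
  and finite_inports: "V \<in> nodes G \<Longrightarrow> finite (inports G V)"
  and finite_outports: "V \<in> nodes G \<Longrightarrow> finite (outports G V)"
  and edgeD: "(e, e') \<in> edges G \<Longrightarrow> e \<in> outs (nodes G) \<and> e' \<in> ins (nodes G)"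
  using network by (auto simp: is_network_def outs_def ins_def)

lemma outports_unique:
  "V \<in> nodes G \<Longrightarrow> W \<in> nodes G \<Longrightarrow> e \<in> outports G V \<Longrightarrow> e \<in> outports G W \<Longrightarrow> V = W"
  and inports_unique:
  "V \<in> nodes G \<Longrightarrow> W \<in> nodes G \<Longrightarrow> e \<in> inports G V \<Longrightarrow> e \<in> inports G W \<Longrightarrow> V = W"
  and inports_outports:
  "V \<in> nodes G \<Longrightarrow> W \<in> nodes G \<Longrightarrow> e \<in> inports G V \<Longrightarrow> e \<notin> outports G W"
  using network unfolding is_network_def by blast+

lemma owner_eq: "V \<in> nodes G \<Longrightarrow> e \<in> outports G V \<Longrightarrow> owner e = V"
  unfolding owner_def by (rule the_equality) (auto intro: outports_unique)

lemma finite_outs: "\<Omega> \<subseteq> nodes G \<Longrightarrow> finite (outs \<Omega>)"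
  and finite_ins: "\<Omega> \<subseteq> nodes G \<Longrightarrow> finite (ins \<Omega>)"
  using finite_nodes finite_inports finite_outports finite_subset[of \<Omega> "nodes G"]
  by (auto simp: outs_def ins_def intro!: finite_UN_I)

lemma finite_edges_into: "finite {e. (e, e') \<in> edges G}"
  by (rule finite_subset[OF _ finite_outs[OF subset_refl]]) (auto dest: edgeD)

section \<open>Superposition and existence of transmissions\<close>

text \<open>Superposition: \<open>H i\<close> is the response to the \<open>i\<close>-th unit source
  vector, so its values at the ports are column \<open>i\<close> of the transfer matrix.\<close>

lemma transmission_linear_combination:
  assumes "\<And>i. i \<in> {1..\<mu>} \<Longrightarrow> transmission G S \<mu> \<alpha> \<beta> (\<lambda>j. if j = i then 1 else 0) (H i)"
  shows "transmission G S \<mu> \<alpha> \<beta> x (\<lambda>e. \<Sum>i=1..\<mu>. x i * H i e)"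
  unfolding transmission_def
proof (intro conjI ballI)
  fix V e assume V: "V \<in> nodes G" "e \<in> outports G V"
  have H: "H i e = (\<Sum>e'\<in>inports G V. \<beta> e' e * H i e') + (if V = S then \<alpha> i e else 0)"
    if "i \<in> {1..\<mu>}" for i
  proof -
    have "(\<Sum>j=1..\<mu>. \<alpha> j e * (if j = i then 1 else 0)) = (\<Sum>j=1..\<mu>. if j = i then \<alpha> i e else 0)"
      by (intro sum.cong) auto
    also have "\<dots> = \<alpha> i e" using that by simp
    finally show ?thesis using assms[OF that] V unfolding transmission_def by auto
  qed
  have "(\<Sum>i=1..\<mu>. x i * H i e) =
    (\<Sum>i=1..\<mu>. (\<Sum>e'\<in>inports G V. \<beta> e' e * (x i * H i e')) + (if V = S then \<alpha> i e * x i else 0))"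
    by (intro sum.cong refl, subst H) (auto simp: distrib_left sum_distrib_left algebra_simps)
  also have "\<dots> = (\<Sum>e'\<in>inports G V. \<beta> e' e * (\<Sum>i=1..\<mu>. x i * H i e')) +
    (if V = S then \<Sum>i=1..\<mu>. \<alpha> i e * x i else 0)"
    by (auto simp: sum.distrib sum_distrib_left intro: sum.swap)
  finally show "(\<Sum>i=1..\<mu>. x i * H i e) = \<dots>" .
next
  fix V e' assume V: "V \<in> nodes G" "e' \<in> inports G V"
  have "(\<Sum>i=1..\<mu>. x i * H i e') = (\<Sum>i=1..\<mu>. \<Sum>e | (e, e') \<in> edges G. x i * H i e)"
    using assms V unfolding transmission_def by (intro sum.cong) (auto simp: sum_distrib_left)
  also have "\<dots> = (\<Sum>e | (e, e') \<in> edges G. \<Sum>i=1..\<mu>. x i * H i e)" by (rule sum.swap)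
  finally show "(\<Sum>i=1..\<mu>. x i * H i e') = \<dots>" .
qed

text \<open>The port equations are a square linear system, so uniqueness of the solution over the
  finite field gives its existence.\<close>
lemma ex_transmission:
  assumes \<alpha>: "\<And>i e. \<alpha> i e \<in> L" and \<beta>: "\<And>e' e. \<beta> e' e \<in> L"
    and x: "\<And>i. i \<in> {1..\<mu>} \<Longrightarrow> x i \<in> L"
  shows "\<exists>y. transmission G S \<mu> \<alpha> \<beta> x y \<and> (\<forall>e. y e \<in> L)"
proof -
  define P where "P = outs (nodes G) \<union> ins (nodes G)"
  \<comment> \<open>\<open>\<Phi>\<close> is the homogeneous right-hand side of the port equations
    and \<open>src\<close> the contribution of the source; the task is to solve
    \<open>\<Psi> y = src\<close> on the port set \<open>P\<close>.\<close>
  define \<Phi> where "\<Phi> y p = (if p \<in> outs (nodes G) then \<Sum>e'\<in>inports G (owner p). \<beta> e' p * y e'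
    else \<Sum>e | (e, p) \<in> edges G. y e)" for y :: "'p \<Rightarrow> 'k" and p
  define \<Psi> where "\<Psi> y = (\<lambda>p\<in>P. y p - \<Phi> y p)" for y
  define src where "src p = (if p \<in> outports G S then \<Sum>i=1..\<mu>. \<alpha> i p * x i else 0)" for p
  have \<Phi>_out: "\<Phi> y e = (\<Sum>e'\<in>inports G V. \<beta> e' e * y e')"
    if "V \<in> nodes G" "e \<in> outports G V" for V e y
    using that owner_eq by (auto simp: \<Phi>_def outs_def)
  have \<Phi>_in: "\<Phi> y e' = (\<Sum>e | (e, e') \<in> edges G. y e)"
    if "V \<in> nodes G" "e' \<in> inports G V" for V e' y
    using that inports_outports by (auto simp: \<Phi>_def outs_def)
  have port_P: "p \<in> P" if "V \<in> nodes G" "p \<in> inports G V \<union> outports G V" for V p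
    using that by (auto simp: P_def outs_def ins_def)
  have pred_P: "e \<in> P" if "(e, e') \<in> edges G" for e e'
    using edgeD[OF that] by (auto simp: P_def)
  have finP: "finite (P \<rightarrow>\<^sub>E L)"
    using finite_outs finite_ins finite_L by (simp add: P_def finite_PiE)
  have maps: "\<Psi> ` (P \<rightarrow>\<^sub>E L) \<subseteq> P \<rightarrow>\<^sub>E L"
  proof (rule image_subsetI, rule PiE_I)
    fix y p assume y: "y \<in> P \<rightarrow>\<^sub>E L" and p: "p \<in> P"
    then obtain V where V: "V \<in> nodes G" "p \<in> inports G V \<union> outports G V"
      by (auto simp: P_def outs_def ins_def)
    have y': "y e \<in> L" if "e \<in> P" for e using y that by auto
    have "\<Phi> y p \<in> L"
    proof (cases "p \<in> outports G V")
      case True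
      then show ?thesis using V port_P y' by (auto simp: \<Phi>_out[OF V(1)] intro!: sum_L mult_L \<beta>)
    next
      case False
      then show ?thesis using V pred_P y' by (auto simp: \<Phi>_in[OF V(1)] intro!: sum_L)
    qed
    then show "\<Psi> y p \<in> L" using p y' by (simp add: \<Psi>_def diff_L)
  qed (simp add: \<Psi>_def)
  have inj: "inj_on \<Psi> (P \<rightarrow>\<^sub>E L)"
  proof (rule inj_onI)
    fix y z assume y: "y \<in> P \<rightarrow>\<^sub>E L" and z: "z \<in> P \<rightarrow>\<^sub>E L" and eq: "\<Psi> y = \<Psi> z"
    define w where "w p = y p - z p" for p
    have w: "w p = \<Phi> y p - \<Phi> z p" if "p \<in> P" for p
      using fun_cong[OF eq, of p] that by (simp add: \<Psi>_def w_def algebra_simps)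
    \<comment> \<open>The source terms cancel in the difference, so \<open>w\<close> is a
      transmission of the zero source vector and can be compared with the zero transmission.\<close>
    have "transmission G S \<mu> \<alpha> \<beta> (\<lambda>_. 0) w"
      unfolding transmission_def
    proof (intro conjI ballI)
      fix V e assume V: "V \<in> nodes G" "e \<in> outports G V"
      have "w e = \<Phi> y e - \<Phi> z e" using w port_P V by blast
      also have "\<dots> = (\<Sum>e'\<in>inports G V. \<beta> e' e * w e')"
        by (simp add: \<Phi>_out[OF V] w_def sum_subtractf right_diff_distrib)
      finally show "w e = (\<Sum>e'\<in>inports G V. \<beta> e' e * w e') +
        (if V = S then \<Sum>i=1..\<mu>. \<alpha> i e * 0 else 0)" by simp
    next
      fix V e' assume V: "V \<in> nodes G" "e' \<in> inports G V"
      have "w e' = \<Phi> y e' - \<Phi> z e'" using w port_P V by blast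
      also have "\<dots> = (\<Sum>e | (e, e') \<in> edges G. w e)"
        by (simp add: \<Phi>_in[OF V] w_def sum_subtractf)
      finally show "w e' = (\<Sum>e | (e, e') \<in> edges G. w e)" .
    qed
    moreover have "transmission G S \<mu> \<alpha> \<beta> (\<lambda>_. 0) (\<lambda>_. 0)"
      unfolding transmission_def by auto
    ultimately have "w p = 0" if "p \<in> P" for p
      using transmission_unique[OF network acyc, of S \<mu> \<alpha> \<beta> "\<lambda>_. 0" w "\<lambda>_. 0"] that
      by (auto simp: P_def outs_def ins_def)
    then have "y p = z p" if "p \<in> P" for p using that by (simp add: w_def)
    then show "y = z" using PiE_ext[OF y z] by blast
  qed
  have surj: "\<Psi> ` (P \<rightarrow>\<^sub>E L) = P \<rightarrow>\<^sub>E L" by (rule endo_inj_surj[OF finP maps inj])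
  have "restrict src P \<in> P \<rightarrow>\<^sub>E L" using \<alpha> x by (auto simp: src_def intro!: sum_L mult_L zero_L)
  then obtain y where y: "y \<in> P \<rightarrow>\<^sub>E L" "\<Psi> y = restrict src P" using surj by (metis imageE)
  \<comment> \<open>Off \<open>P\<close> the function \<open>y\<close> is \<open>undefined\<close>,
    which need not lie in \<open>L\<close>; the default 0 does.\<close>
  define y' where "y' p = (if p \<in> P then y p else 0)" for p
  have eq: "y' p = \<Phi> y p + src p" if "p \<in> P" for p
    using fun_cong[OF y(2), of p] that by (simp add: \<Psi>_def y'_def algebra_simps)
  have out: "y' e = (\<Sum>e'\<in>inports G V. \<beta> e' e * y' e') +
      (if V = S then \<Sum>i=1..\<mu>. \<alpha> i e * x i else 0)" if V: "V \<in> nodes G" "e \<in> outports G V" for V e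
  proof -
    have "(e \<in> outports G S) = (V = S)" using V S outports_unique by blast
    moreover have "(\<Sum>e'\<in>inports G V. \<beta> e' e * y e') = (\<Sum>e'\<in>inports G V. \<beta> e' e * y' e')"
      using port_P V by (intro sum.cong) (auto simp: y'_def)
    ultimately show ?thesis using eq[of e] port_P V by (simp add: src_def \<Phi>_out[OF V])
  qed
  have inp: "y' e' = (\<Sum>e | (e, e') \<in> edges G. y' e)" if V: "V \<in> nodes G" "e' \<in> inports G V" for V e'
  proof -
    have "src e' = 0" using V S inports_outports by (auto simp: src_def)
    moreover have "(\<Sum>e | (e, e') \<in> edges G. y e) = (\<Sum>e | (e, e') \<in> edges G. y' e)"
      using pred_P by (intro sum.cong) (auto simp: y'_def)
    ultimately show ?thesis using eq[of e'] port_P V by (simp add: \<Phi>_in[OF V])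
  qed
  have "y' e \<in> L" for e using y(1) by (auto simp: y'_def zero_L)
  then show ?thesis using out inp unfolding transmission_def by blast
qed

section \<open>Cut matrices and the necessity bound\<close>

lemma q_gt_1: "q > 1"
proof -
  have "card {0, 1 :: 'k} \<le> q" using finite_L zero_L one_L by (intro card_mono) auto
  then show ?thesis by simp
qed

text \<open>Gives the row space its meaning: a combination of rows weighted by the output symbols of
  \<open>\<Omega>\<close> is what crosses the cut into each input port on the far side.\<close>

lemma cut_matrix_row_sum:
  assumes "\<Omega> \<subseteq> nodes G" "e' \<in> ins (nodes G - \<Omega>)"
  shows "(\<Sum>e\<in>outs \<Omega>. z e * h (cut_matrix G \<Omega> e e')) = (\<Sum>e | (e, e') \<in> edges G \<and> e \<in> outs \<Omega>. z e)"
proof -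
  have "(\<Sum>e\<in>outs \<Omega>. z e * h (cut_matrix G \<Omega> e e')) =
    (\<Sum>e\<in>outs \<Omega>. if (e, e') \<in> edges G then z e else 0)"
    using assms(2) by (intro sum.cong) (auto simp: cut_matrix_def outs_def ins_def h_0 h_1)
  also have "\<dots> = (\<Sum>e\<in>outs \<Omega> \<inter> {e. (e, e') \<in> edges G}. z e)"
    by (simp add: sum.If_cases finite_outs[OF assms(1)])
  finally show ?thesis by (simp add: Int_def conj_commute)
qed

lemma cut_matrix_support: "e' \<notin> ins (nodes G) \<Longrightarrow> cut_matrix G \<Omega> e e' = 0"
  by (auto simp: cut_matrix_def ins_def)

lemma matrix_rank_cut: "matrix_rank (cut_matrix G \<Omega>) (outs \<Omega>) = cut_rank TYPE('f) G \<Omega>"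
  by (simp add: cut_rank_def outs_def)

text \<open>What crosses the cut determines every symbol outside \<open>\<Omega>\<close>, hence
  every process of \<open>D\<close>. So the \<open>q ^ card D\<close> value tuples of
  \<open>D\<close> inject into the row space of the cut matrix over \<open>L\<close>, whose size is
  bounded by the rank over the base field.\<close>

lemma decodable_le_cut_rank:
  assumes \<alpha>: "\<And>i e. \<alpha> i e \<in> L" and \<beta>: "\<And>e' e. \<beta> e' e \<in> L"
    and y: "\<And>x. x \<in> {1..\<mu>} \<rightarrow>\<^sub>E L \<Longrightarrow> transmission G S \<mu> \<alpha> \<beta> x (y x)"
    and \<Omega>: "\<Omega> \<subseteq> nodes G" "S \<in> \<Omega>" and D: "D \<subseteq> {1..\<mu>}"
    and dec: "\<And>j. j \<in> D \<Longrightarrow> \<exists>\<tau>\<in>nodes G - \<Omega>. \<exists>k. \<forall>x \<in> {1..\<mu>} \<rightarrow>\<^sub>E L. received G \<epsilon> (y x) \<tau> k = x j"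
  shows "card D \<le> cut_rank TYPE('f) G \<Omega>"
proof -
  define R where "R = (\<lambda>z j. \<Sum>e\<in>outs \<Omega>. z e * h (cut_matrix G \<Omega> e j)) ` (outs \<Omega> \<rightarrow>\<^sub>E L)"
  \<comment> \<open>Source processes outside \<open>D\<close> are fixed to 0, leaving exactly the
    tuples over \<open>D\<close> as inputs.\<close>
  define pad where "pad x = (\<lambda>i\<in>{1..\<mu>}. if i \<in> D then x i else 0)" for x :: "nat \<Rightarrow> 'k"
  define cutv where "cutv x = (\<lambda>j. \<Sum>e\<in>outs \<Omega>. y (pad x) e * h (cut_matrix G \<Omega> e j))" for x
  have finD: "finite D" using D finite_subset by blast
  have pad: "pad x \<in> {1..\<mu>} \<rightarrow>\<^sub>E L" if "x \<in> D \<rightarrow>\<^sub>E L" for x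
    using that by (auto simp: pad_def zero_L)
  have "cutv x \<in> R" if x: "x \<in> D \<rightarrow>\<^sub>E L" for x
  proof -
    \<comment> \<open>The given \<open>y\<close> is not assumed to take values in \<open>L\<close>;
      it does so on the ports by comparison with a transmission that lies in
      \<open>L\<close>.\<close>
    obtain z where z: "transmission G S \<mu> \<alpha> \<beta> (pad x) z" "\<forall>e. z e \<in> L"
      using ex_transmission[of \<alpha> \<beta> "pad x", OF \<alpha> \<beta> PiE_mem[OF pad[OF x]]] by blast
    have "z e = y (pad x) e" if "e \<in> outs \<Omega>" for e
      using transmission_unique[OF network acyc z(1) y[OF pad[OF x]]] that \<Omega>(1)
      by (auto simp: outs_def)
    then have "cutv x = (\<lambda>j. \<Sum>e\<in>outs \<Omega>. restrict z (outs \<Omega>) e * h (cut_matrix G \<Omega> e j))"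
      unfolding cutv_def by (intro ext sum.cong) auto
    moreover have "restrict z (outs \<Omega>) \<in> outs \<Omega> \<rightarrow>\<^sub>E L" using z(2) by simp
    ultimately show ?thesis unfolding R_def by blast
  qed
  then have sub: "cutv ` (D \<rightarrow>\<^sub>E L) \<subseteq> R" by blast
  have inj: "inj_on cutv (D \<rightarrow>\<^sub>E L)"
  proof (rule inj_onI)
    fix x x' assume x: "x \<in> D \<rightarrow>\<^sub>E L" and x': "x' \<in> D \<rightarrow>\<^sub>E L" and eq: "cutv x = cutv x'"
    note tx = y[OF pad[OF x]] and tx' = y[OF pad[OF x']]
    have "arcs G \<subseteq> nodes G \<times> nodes G" by (auto simp: arcs_def)
    then have "finite (arcs G)" using finite_nodes by (meson finite_SigmaI finite_subset)
    then have "wf (arcs G)" using acyc finite_acyclic_wf by (auto simp: acyclic_network_def)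
    \<comment> \<open>Induction along the arcs. An input outside \<open>\<Omega>\<close> splits into
      a part from \<open>\<Omega>\<close>, fixed by the equal cut vectors, and a part from earlier
      nodes outside \<open>\<Omega>\<close>, fixed by induction. As \<open>S\<close> lies in
      \<open>\<Omega>\<close>, no source term enters.\<close>
    then have same: "V \<in> nodes G - \<Omega> \<Longrightarrow>
      \<forall>e\<in>inports G V \<union> outports G V. y (pad x) e = y (pad x') e" for V
    proof (induction V rule: wf_induct_rule)
      case (less V)
      have V: "V \<in> nodes G" "V \<notin> \<Omega>" "V \<noteq> S" using less.prems \<Omega>(2) by auto
      have inp: "y (pad x) e' = y (pad x') e'" if e': "e' \<in> inports G V" for e'
      proof -
        have far: "y (pad x) e = y (pad x') e" if e: "(e, e') \<in> edges G" "e \<notin> outs \<Omega>" for e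
        proof -
          obtain W where W: "W \<in> nodes G" "e \<in> outports G W"
            using edgeD[OF e(1)] by (auto simp: outs_def)
          moreover have "W \<notin> \<Omega>" using W e(2) by (auto simp: outs_def)
          moreover have "(W, V) \<in> arcs G" using W e(1) e' V by (auto simp: arcs_def)
          ultimately show ?thesis using less.IH by blast
        qed
        have "e' \<in> ins (nodes G - \<Omega>)" using e' V by (auto simp: ins_def)
        from cut_matrix_row_sum[OF \<Omega>(1) this]
        have near: "(\<Sum>e | (e, e') \<in> edges G \<and> e \<in> outs \<Omega>. y (pad x) e) =
            (\<Sum>e | (e, e') \<in> edges G \<and> e \<in> outs \<Omega>. y (pad x') e)"
          using fun_cong[OF eq, of e'] by (simp add: cutv_def)
        have split: "(\<Sum>e | (e, e') \<in> edges G. f e) =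
            (\<Sum>e | (e, e') \<in> edges G \<and> e \<in> outs \<Omega>. f e) +
            (\<Sum>e | (e, e') \<in> edges G \<and> e \<notin> outs \<Omega>. f e)" for f :: "'p \<Rightarrow> 'k"
          using finite_edges_into[of e']
          by (subst sum.union_disjoint[symmetric]) (auto intro!: sum.cong)
        show ?thesis
          using tx tx' e' V(1) near far unfolding transmission_def by (simp add: split)
      qed
      moreover have "y (pad x) e = y (pad x') e" if "e \<in> outports G V" for e
        using tx tx' that V inp unfolding transmission_def by simp
      ultimately show ?case by blast
    qed
    have "x j = x' j" if j: "j \<in> D" for j
    proof -
      obtain \<tau> k where \<tau>: "\<tau> \<in> nodes G - \<Omega>"
        "\<forall>x \<in> {1..\<mu>} \<rightarrow>\<^sub>E L. received G \<epsilon> (y x) \<tau> k = x j" using dec[OF j] by blast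
      have "received G \<epsilon> (y (pad x)) \<tau> k = received G \<epsilon> (y (pad x')) \<tau> k"
        unfolding received_def using same[OF \<tau>(1)] by (intro sum.cong) auto
      then have "pad x j = pad x' j" using \<tau>(2) pad[OF x] pad[OF x'] by simp
      then show ?thesis using j D by (auto simp: pad_def)
    qed
    then show "x = x'" using x x' by (auto intro: PiE_ext)
  qed
  have "finite R" using finite_outs[OF \<Omega>(1)] finite_L by (simp add: R_def finite_PiE)
  then have "card (D \<rightarrow>\<^sub>E L) \<le> card R" by (rule card_inj_on_le[OF inj sub])
  also have "\<dots> \<le> q ^ cut_rank TYPE('f) G \<Omega>"
    unfolding R_def matrix_rank_cut[symmetric]
    by (rule card_row_space_le[OF finite_outs[OF \<Omega>(1)] finite_ins[OF subset_refl]])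
      (rule cut_matrix_support)
  finally have "q ^ card D \<le> q ^ cut_rank TYPE('f) G \<Omega>" using finD by (simp add: card_funcsetE)
  then show ?thesis using q_gt_1 by simp
qed

end

subsection \<open>Random codes\<close>

context coded_network
begin

text \<open>The coefficients are cut down to finite index sets so that codes can be counted. They
  are grouped by the output port or destination component whose equation they enter, so that
  different equations constrain different rows; \<open>\<alpha>_of\<close>,
  \<open>\<beta>_of\<close> and \<open>\<epsilon>_of\<close> restore the argument order of
  \<open>transmission\<close> and \<open>received\<close>.\<close>

definition \<alpha>_codes :: "('p \<Rightarrow> nat \<Rightarrow> 'k) set" where
  "\<alpha>_codes = outports G S \<rightarrow>\<^sub>E ({1..\<mu>} \<rightarrow>\<^sub>E L)"
definition \<beta>_codes :: "('p \<Rightarrow> 'p \<Rightarrow> 'k) set" where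
  "\<beta>_codes = (outs (nodes G) - outports G S) \<rightarrow>\<^sub>E (ins (nodes G) \<rightarrow>\<^sub>E L)"
definition \<epsilon>_codes :: "('v \<times> nat \<Rightarrow> 'p \<Rightarrow> 'k) set" where
  "\<epsilon>_codes = (nodes G \<times> {1..\<mu>}) \<rightarrow>\<^sub>E (ins (nodes G) \<rightarrow>\<^sub>E L)"

definition \<alpha>_of :: "('p \<Rightarrow> nat \<Rightarrow> 'k) \<Rightarrow> nat \<Rightarrow> 'p \<Rightarrow> 'k" where
  "\<alpha>_of a i e = (if e \<in> outports G S \<and> i \<in> {1..\<mu>} then a e i else 0)"
text \<open>The source ignores its input ports, so that its outputs depend on \<open>\<alpha>\<close> alone.\<close>
definition \<beta>_of :: "('p \<Rightarrow> 'p \<Rightarrow> 'k) \<Rightarrow> 'p \<Rightarrow> 'p \<Rightarrow> 'k" where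
  "\<beta>_of b e' e = (if e \<in> outs (nodes G) - outports G S \<and> e' \<in> ins (nodes G) then b e e' else 0)"
definition \<epsilon>_of :: "('v \<times> nat \<Rightarrow> 'p \<Rightarrow> 'k) \<Rightarrow> 'p \<Rightarrow> 'v \<Rightarrow> nat \<Rightarrow> 'k" where
  "\<epsilon>_of c e' V k = (if V \<in> nodes G \<and> k \<in> {1..\<mu>} \<and> e' \<in> ins (nodes G) then c (V, k) e' else 0)"

text \<open>For \<open>x\<close> with entries in \<open>L\<close>, these are the codes whose joint
  transfer matrix to \<open>\<Theta>\<close> has \<open>x\<close> in its kernel. The existential
  over \<open>y\<close> adds no freedom, as \<open>transmission_unique\<close> fixes
  \<open>y\<close> on the ports.\<close>

definition bad :: "'v set \<Rightarrow> ('v \<Rightarrow> nat) \<Rightarrow> (nat \<Rightarrow> 'k) \<Rightarrow>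
    (('p \<Rightarrow> nat \<Rightarrow> 'k) \<times> ('p \<Rightarrow> 'p \<Rightarrow> 'k) \<times> ('v \<times> nat \<Rightarrow> 'p \<Rightarrow> 'k)) set" where
  "bad \<Theta> d x = {(a, b, c) \<in> \<alpha>_codes \<times> \<beta>_codes \<times> \<epsilon>_codes.
    \<exists>y. transmission G S \<mu> (\<alpha>_of a) (\<beta>_of b) x y \<and> (\<forall>e. y e \<in> L) \<and>
      (\<forall>\<tau>\<in>\<Theta>. \<forall>k\<in>{1..d \<tau>}. received G (\<epsilon>_of c) y \<tau> k = 0)}"

lemma codes_L:
  "a \<in> \<alpha>_codes \<Longrightarrow> \<alpha>_of a i e \<in> L"
  "b \<in> \<beta>_codes \<Longrightarrow> \<beta>_of b e' e \<in> L"
  "c \<in> \<epsilon>_codes \<Longrightarrow> \<epsilon>_of c e' V k \<in> L"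
  by (auto simp: \<alpha>_of_def \<beta>_of_def \<epsilon>_of_def \<alpha>_codes_def \<beta>_codes_def \<epsilon>_codes_def zero_L PiE_iff)

lemma finite_codes: "finite \<alpha>_codes" "finite \<beta>_codes" "finite \<epsilon>_codes"
  using finite_L finite_outs[OF subset_refl] finite_ins[OF subset_refl] finite_nodes finite_outports[OF S]
  by (simp_all add: \<alpha>_codes_def \<beta>_codes_def \<epsilon>_codes_def finite_PiE)

text \<open>If all output ports outside \<open>\<Omega>\<close> carry 0, this is the whole symbol at
  the input port.\<close>

definition inflow :: "'v set \<Rightarrow> ('p \<Rightarrow> 'k) \<Rightarrow> 'p \<Rightarrow> 'k" where
  "inflow \<Omega> z e' = (\<Sum>e | (e, e') \<in> edges G \<and> e \<in> outs \<Omega>. z e)"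

text \<open>The possible outputs of \<open>\<Omega>\<close> when \<open>\<Omega>\<close> consists of the source and the
  nodes with a nonzero input.\<close>
definition reach_outputs :: "'v set \<Rightarrow> ('p \<Rightarrow> 'k) set" where
  "reach_outputs \<Omega> = {z \<in> outs \<Omega> \<rightarrow>\<^sub>E L.
     (\<forall>j\<in>ins (nodes G). (\<Sum>e\<in>outs \<Omega>. z e * h (cut_matrix G \<Omega> e j)) = 0) \<and>
     (\<forall>V\<in>\<Omega> - {S}. \<exists>e'\<in>inports G V. inflow \<Omega> z e' \<noteq> 0)}"

text \<open>Once \<open>\<Omega>\<close> and \<open>z\<close> are fixed, the inputs are known and
  the conditions become linear equations in the coefficients. They separate into equations for
  \<open>\<alpha>\<close>, \<open>\<beta>\<close> and \<open>\<epsilon>\<close>, hence the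
  product.\<close>

definition producing :: "'v set \<Rightarrow> ('v \<Rightarrow> nat) \<Rightarrow> (nat \<Rightarrow> 'k) \<Rightarrow> 'v set \<Rightarrow> ('p \<Rightarrow> 'k) \<Rightarrow>
    (('p \<Rightarrow> nat \<Rightarrow> 'k) \<times> ('p \<Rightarrow> 'p \<Rightarrow> 'k) \<times> ('v \<times> nat \<Rightarrow> 'p \<Rightarrow> 'k)) set" where
  "producing \<Theta> d x \<Omega> z =
    {a \<in> \<alpha>_codes. \<forall>e\<in>outports G S. (\<Sum>i\<in>{1..\<mu>}. a e i * x i) = z e} \<times>
    {b \<in> \<beta>_codes. \<forall>e\<in>outs \<Omega> - outports G S.
       (\<Sum>e'\<in>inports G (owner e). b e e' * inflow \<Omega> z e') = z e} \<times>
    {c \<in> \<epsilon>_codes. \<forall>p\<in>Sigma (\<Theta> \<inter> \<Omega>) (\<lambda>\<tau>. {1..d \<tau>}).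
       (\<Sum>e'\<in>inports G (fst p). c p e' * inflow \<Omega> z e') = 0}"

text \<open>No equation is degenerate: at the source \<open>x\<close> is nonzero, and every other
  node of \<open>\<Omega>\<close> has a nonzero inflow. Each output port of \<open>\<Omega>\<close>
  and each component at a destination in \<open>\<Omega>\<close> therefore costs a factor
  \<open>q\<close>.\<close>

lemma card_producing_le:
  assumes \<Omega>: "\<Omega> \<subseteq> nodes G" "S \<in> \<Omega>" and z: "z \<in> reach_outputs \<Omega>"
    and \<Theta>: "\<Theta> \<subseteq> nodes G - {S}" and d: "\<And>\<tau>. \<tau> \<in> \<Theta> \<Longrightarrow> d \<tau> \<le> \<mu>"
    and x: "\<exists>i\<in>{1..\<mu>}. x i \<noteq> 0"
  shows "card (producing \<Theta> d x \<Omega> z) * q ^ (card (outs \<Omega>) + (\<Sum>\<tau>\<in>\<Theta> \<inter> \<Omega>. d \<tau>))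
    \<le> card (\<alpha>_codes \<times> \<beta>_codes \<times> \<epsilon>_codes)"
proof -
  have finN: "finite (ins (nodes G))" "finite (outs (nodes G))"
    using finite_ins finite_outs by auto
  have nz: "\<exists>e'\<in>inports G V. inflow \<Omega> z e' \<noteq> 0" if "V \<in> \<Omega> - {S}" for V
    using z that by (auto simp: reach_outputs_def)
  have sub_ins: "inports G V \<subseteq> ins (nodes G)" if "V \<in> \<Omega>" for V
    using that \<Omega>(1) by (auto simp: ins_def)
  have owner: "owner e \<in> \<Omega> - {S}" if "e \<in> outs \<Omega> - outports G S" for e
    using that \<Omega>(1) owner_eq by (auto simp: outs_def)
  have A: "card {a \<in> \<alpha>_codes. \<forall>e\<in>outports G S. (\<Sum>i\<in>{1..\<mu>}. a e i * x i) = z e} *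
      q ^ card (outports G S) \<le> card \<alpha>_codes"
    unfolding \<alpha>_codes_def
    using card_linear_equations_le[of "outports G S" "{1..\<mu>}" "outports G S" "\<lambda>_. {1..\<mu>}" "\<lambda>_. x" z]
      finite_outports[OF S] x by auto
  have B: "card {b \<in> \<beta>_codes. \<forall>e\<in>outs \<Omega> - outports G S.
        (\<Sum>e'\<in>inports G (owner e). b e e' * inflow \<Omega> z e') = z e} *
      q ^ card (outs \<Omega> - outports G S) \<le> card \<beta>_codes"
    unfolding \<beta>_codes_def
  proof (rule card_linear_equations_le)
    show "outs \<Omega> - outports G S \<subseteq> outs (nodes G) - outports G S"
      using \<Omega>(1) by (auto simp: outs_def)
  qed (use finN owner sub_ins nz in \<open>auto simp del: Diff_iff\<close>)
  have C: "card {c \<in> \<epsilon>_codes. \<forall>p\<in>Sigma (\<Theta> \<inter> \<Omega>) (\<lambda>\<tau>. {1..d \<tau>}).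
        (\<Sum>e'\<in>inports G (fst p). c p e' * inflow \<Omega> z e') = 0} *
      q ^ card (Sigma (\<Theta> \<inter> \<Omega>) (\<lambda>\<tau>. {1..d \<tau>})) \<le> card \<epsilon>_codes"
    unfolding \<epsilon>_codes_def
  proof (rule card_linear_equations_le)
    show "Sigma (\<Theta> \<inter> \<Omega>) (\<lambda>\<tau>. {1..d \<tau>}) \<subseteq> nodes G \<times> {1..\<mu>}" using \<Theta> d by force
    show "\<exists>i\<in>inports G (fst e). inflow \<Omega> z i \<noteq> 0" if "e \<in> Sigma (\<Theta> \<inter> \<Omega>) (\<lambda>\<tau>. {1..d \<tau>})" for e
      by (rule nz) (use that \<Theta> in auto)
    show "inports G (fst e) \<subseteq> ins (nodes G)" if "e \<in> Sigma (\<Theta> \<inter> \<Omega>) (\<lambda>\<tau>. {1..d \<tau>})" for e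
      by (rule sub_ins) (use that in auto)
  qed (use finN finite_nodes in auto)
  have "finite \<Theta>" using \<Theta> finite_nodes finite_subset by blast
  then have cardC: "card (Sigma (\<Theta> \<inter> \<Omega>) (\<lambda>\<tau>. {1..d \<tau>})) = (\<Sum>\<tau>\<in>\<Theta> \<inter> \<Omega>. d \<tau>)" by simp
  have cardO: "card (outs \<Omega>) = card (outports G S) + card (outs \<Omega> - outports G S)"
  proof -
    have "outports G S \<subseteq> outs \<Omega>" using \<Omega>(2) by (auto simp: outs_def)
    then show ?thesis
      using finite_outs[OF \<Omega>(1)] by (metis card_Diff_subset card_mono finite_subset le_add_diff_inverse)
  qed
  from mult_le_mono[OF A mult_le_mono[OF B C]]
  show ?thesis
    unfolding producing_def card_cartesian_product cardO cardC power_add by (simp add: mult_ac)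
qed

lemma card_reach_outputs_le:
  assumes \<Omega>: "\<Omega> \<subseteq> nodes G"
  shows "card (reach_outputs \<Omega>) * q ^ cut_rank TYPE('f) G \<Omega> \<le> q ^ card (outs \<Omega>)"
proof -
  have fin: "finite (outs \<Omega> \<rightarrow>\<^sub>E L)" using finite_outs[OF \<Omega>] finite_L by (simp add: finite_PiE)
  have "card (reach_outputs \<Omega>) \<le> card {z \<in> outs \<Omega> \<rightarrow>\<^sub>E L.
     \<forall>j\<in>ins (nodes G). (\<Sum>e\<in>outs \<Omega>. z e * h (cut_matrix G \<Omega> e j)) = 0}"
    by (rule card_mono) (use fin in \<open>auto simp: reach_outputs_def\<close>)
  then have "card (reach_outputs \<Omega>) * q ^ matrix_rank (cut_matrix G \<Omega>) (outs \<Omega>) \<le>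
    card {z \<in> outs \<Omega> \<rightarrow>\<^sub>E L.
     \<forall>j\<in>ins (nodes G). (\<Sum>e\<in>outs \<Omega>. z e * h (cut_matrix G \<Omega> e j)) = 0} *
    q ^ matrix_rank (cut_matrix G \<Omega>) (outs \<Omega>)" by simp
  also have "\<dots> \<le> q ^ card (outs \<Omega>)"
    by (rule card_left_kernel_le[OF finite_outs[OF \<Omega>] finite_ins[OF subset_refl]])
      (rule cut_matrix_support)
  finally show ?thesis by (simp only: matrix_rank_cut)
qed

text \<open>Bad codes are classified by the support of their transmission, from which
  \<open>\<Omega>\<close> and \<open>z\<close> are read off. Nodes outside \<open>\<Omega>\<close>
  have zero inputs and are not the source, so they are silent, and \<open>inflow\<close> is the
  whole symbol at each input port.\<close>

lemma bad_subset:
  assumes \<Theta>: "\<Theta> \<subseteq> nodes G - {S}" and d: "\<And>\<tau>. \<tau> \<in> \<Theta> \<Longrightarrow> d \<tau> \<le> \<mu>"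
  shows "bad \<Theta> d x \<subseteq> (\<Union>\<Omega>\<in>{\<Omega>. \<Omega> \<subseteq> nodes G \<and> S \<in> \<Omega>}. \<Union>z\<in>reach_outputs \<Omega>. producing \<Theta> d x \<Omega> z)"
proof
  fix p assume "p \<in> bad \<Theta> d x"
  then obtain a b c y where p: "p = (a, b, c)"
    and abc: "a \<in> \<alpha>_codes" "b \<in> \<beta>_codes" "c \<in> \<epsilon>_codes"
    and y: "transmission G S \<mu> (\<alpha>_of a) (\<beta>_of b) x y" "\<forall>e. y e \<in> L"
    and rec: "\<forall>\<tau>\<in>\<Theta>. \<forall>k\<in>{1..d \<tau>}. received G (\<epsilon>_of c) y \<tau> k = 0"
    unfolding bad_def by auto
  define \<Omega> where "\<Omega> = insert S {V \<in> nodes G. \<exists>e'\<in>inports G V. y e' \<noteq> 0}"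
  define z where "z = restrict y (outs \<Omega>)"
  have \<Omega>: "\<Omega> \<subseteq> nodes G" "S \<in> \<Omega>" using S by (auto simp: \<Omega>_def)
  have out: "y e = (\<Sum>e'\<in>inports G V. \<beta>_of b e' e * y e') + (if V = S then \<Sum>i=1..\<mu>. \<alpha>_of a i e * x i else 0)"
    if "V \<in> nodes G" "e \<in> outports G V" for V e
    using y(1) that unfolding transmission_def by blast
  have dead: "y e = 0" if "e \<in> outs (nodes G)" "e \<notin> outs \<Omega>" for e
  proof -
    obtain V where V: "V \<in> nodes G" "e \<in> outports G V" "V \<notin> \<Omega>"
      using \<open>e \<in> outs (nodes G)\<close> \<open>e \<notin> outs \<Omega>\<close> unfolding outs_def by blast
    then show ?thesis using out[OF V(1,2)] \<Omega>(2) by (auto simp: \<Omega>_def)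
  qed
  have flow: "inflow \<Omega> z e' = y e'" if V: "V \<in> nodes G" "e' \<in> inports G V" for V e'
  proof -
    have "y e' = (\<Sum>e | (e, e') \<in> edges G. y e)"
      using y(1) V unfolding transmission_def by blast
    also have "\<dots> = (\<Sum>e | (e, e') \<in> edges G \<and> e \<in> outs \<Omega>. z e)"
      by (rule sum.mono_neutral_cong_right) (use finite_edges_into dead edgeD in \<open>auto simp: z_def\<close>)
    finally show ?thesis by (simp add: inflow_def)
  qed
  have "z \<in> reach_outputs \<Omega>"
    unfolding reach_outputs_def
  proof (intro CollectI conjI ballI)
    show "z \<in> outs \<Omega> \<rightarrow>\<^sub>E L" using y(2) by (simp add: z_def)
    fix j assume "j \<in> ins (nodes G)"
    then obtain V where V: "V \<in> nodes G" "j \<in> inports G V" by (auto simp: ins_def)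
    \<comment> \<open>The column of a port inside \<open>\<Omega>\<close> is zero. Outside, the
      column sum is the symbol at the port, which is 0 by the choice of
      \<open>\<Omega>\<close>.\<close>
    show "(\<Sum>e\<in>outs \<Omega>. z e * h (cut_matrix G \<Omega> e j)) = 0"
    proof (cases "V \<in> \<Omega>")
      case True
      then have "j \<notin> ins (nodes G - \<Omega>)" using V inports_unique by (auto simp: ins_def)
      then show ?thesis by (simp add: cut_matrix_def ins_def h_0)
    next
      case False
      then have "j \<in> ins (nodes G - \<Omega>)" using V by (auto simp: ins_def)
      then show ?thesis
        using cut_matrix_row_sum[OF \<Omega>(1), of j z] flow[OF V] False V
        by (auto simp: inflow_def \<Omega>_def)
    qed
  next
    fix V assume "V \<in> \<Omega> - {S}"
    then show "\<exists>e'\<in>inports G V. inflow \<Omega> z e' \<noteq> 0"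
      using flow by (auto simp: \<Omega>_def)
  qed
  moreover have "(a, b, c) \<in> producing \<Theta> d x \<Omega> z"
    unfolding producing_def
  proof (intro SigmaI CollectI conjI ballI abc)
    fix e assume e: "e \<in> outports G S"
    \<comment> \<open>\<open>\<beta>_of\<close> vanishes at the output ports of \<open>S\<close>, so
      only the source term remains.\<close>
    then have "(\<Sum>i = 1..\<mu>. a e i * x i) = y e"
      using out[OF S e] by (simp add: \<alpha>_of_def \<beta>_of_def)
    then show "(\<Sum>i = 1..\<mu>. a e i * x i) = z e" using e \<Omega>(2) by (auto simp: z_def outs_def)
  next
    fix e assume e: "e \<in> outs \<Omega> - outports G S"
    then obtain V where V: "V \<in> \<Omega>" "e \<in> outports G V" "V \<in> nodes G" "V \<noteq> S"
      using \<Omega>(1) by (auto simp: outs_def)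
    have "y e = (\<Sum>e'\<in>inports G V. \<beta>_of b e' e * y e')" using out[OF V(3,2)] V(4) by simp
    also have "\<dots> = (\<Sum>e'\<in>inports G V. b e e' * inflow \<Omega> z e')"
      using e V flow by (intro sum.cong) (auto simp: \<beta>_of_def outs_def ins_def)
    finally show "(\<Sum>e'\<in>inports G (owner e). b e e' * inflow \<Omega> z e') = z e"
      using owner_eq[OF V(3,2)] e by (simp add: z_def)
  next
    fix p assume p: "p \<in> Sigma (\<Theta> \<inter> \<Omega>) (\<lambda>\<tau>. {1..d \<tau>})"
    then have "received G (\<epsilon>_of c) y (fst p) (snd p) = 0" using rec by auto
    moreover have "received G (\<epsilon>_of c) y (fst p) (snd p) =
        (\<Sum>e'\<in>inports G (fst p). c p e' * inflow \<Omega> z e')"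
      unfolding received_def
    proof (intro sum.cong refl)
      fix e' assume e': "e' \<in> inports G (fst p)"
      have P: "fst p \<in> nodes G" "snd p \<in> {1..\<mu>}" using p \<Omega>(1) d by force+
      then show "\<epsilon>_of c e' (fst p) (snd p) * y e' = c p e' * inflow \<Omega> z e'"
        using e' flow[OF P(1) e'] by (auto simp: \<epsilon>_of_def ins_def)
    qed
    ultimately show "(\<Sum>e'\<in>inports G (fst p). c p e' * inflow \<Omega> z e') = 0" by simp
  qed
  ultimately show "p \<in> (\<Union>\<Omega>\<in>{\<Omega>. \<Omega> \<subseteq> nodes G \<and> S \<in> \<Omega>}. \<Union>z\<in>reach_outputs \<Omega>. producing \<Theta> d x \<Omega> z)"
    using \<Omega> unfolding p by blast
qed

text \<open>For fixed \<open>\<Omega>\<close> of cut rank \<open>r\<close>, there are at most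
  \<open>q ^ (card (outs \<Omega>) - r)\<close> choices of \<open>z\<close>, and each is produced by
  a fraction \<open>q ^ -(card (outs \<Omega>) + s)\<close> of the codes at most, where
  \<open>s\<close> is the demand inside \<open>\<Omega>\<close>. The cut condition makes
  \<open>s + r\<close> at least the total demand; the power of 2 counts the sets
  \<open>\<Omega>\<close>.\<close>

lemma card_bad_le:
  assumes \<Theta>: "\<Theta> \<subseteq> nodes G - {S}" and d: "\<And>\<tau>. \<tau> \<in> \<Theta> \<Longrightarrow> d \<tau> \<le> \<mu>"
    and cut: "\<And>\<Omega>. \<Omega> \<subseteq> nodes G \<Longrightarrow> S \<in> \<Omega> \<Longrightarrow> (\<Sum>\<tau>\<in>\<Theta> - \<Omega>. d \<tau>) \<le> cut_rank TYPE('f) G \<Omega>"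
    and x: "\<exists>i\<in>{1..\<mu>}. x i \<noteq> 0"
  shows "card (bad \<Theta> d x) * q ^ (\<Sum>\<tau>\<in>\<Theta>. d \<tau>) \<le>
    2 ^ card (nodes G) * card (\<alpha>_codes \<times> \<beta>_codes \<times> \<epsilon>_codes)"
proof -
  let ?C = "\<alpha>_codes \<times> \<beta>_codes \<times> \<epsilon>_codes"
  let ?\<O> = "{\<Omega>. \<Omega> \<subseteq> nodes G \<and> S \<in> \<Omega>}"
  let ?U = "\<lambda>\<Omega>. \<Union>z\<in>reach_outputs \<Omega>. producing \<Theta> d x \<Omega> z"
  have fin\<Theta>: "finite \<Theta>" using \<Theta> finite_nodes finite_subset by blast
  have finU: "finite (?U \<Omega>)" for \<Omega>
    by (rule finite_subset[of _ ?C]) (use finite_codes in \<open>auto simp: producing_def\<close>)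
  have U: "card (?U \<Omega>) * q ^ (\<Sum>\<tau>\<in>\<Theta>. d \<tau>) \<le> card ?C" if \<Omega>: "\<Omega> \<subseteq> nodes G" "S \<in> \<Omega>" for \<Omega>
  proof -
    let ?o = "card (outs \<Omega>)" and ?s = "\<Sum>\<tau>\<in>\<Theta> \<inter> \<Omega>. d \<tau>" and ?r = "cut_rank TYPE('f) G \<Omega>"
    have finR: "finite (reach_outputs \<Omega>)"
      by (rule finite_subset[of _ "outs \<Omega> \<rightarrow>\<^sub>E L"])
        (use finite_outs[OF \<Omega>(1)] finite_L in \<open>auto simp: reach_outputs_def finite_PiE\<close>)
    have "card (?U \<Omega>) * q ^ (?o + ?s) \<le> (\<Sum>z\<in>reach_outputs \<Omega>. card (producing \<Theta> d x \<Omega> z)) * q ^ (?o + ?s)"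
      by (rule mult_right_mono[OF card_UN_le[OF finR]]) simp
    also have "\<dots> \<le> (\<Sum>z\<in>reach_outputs \<Omega>. card ?C)"
      unfolding sum_distrib_right
      by (intro sum_mono card_producing_le \<Omega> \<Theta> x) (use d in auto)
    finally have "card (?U \<Omega>) * q ^ (?o + ?s) * q ^ ?r \<le> card (reach_outputs \<Omega>) * card ?C * q ^ ?r"
      by (intro mult_right_mono) auto
    also have "\<dots> = card (reach_outputs \<Omega>) * q ^ ?r * card ?C" by (simp only: mult_ac)
    also have "\<dots> \<le> q ^ ?o * card ?C"
      by (rule mult_right_mono[OF card_reach_outputs_le[OF \<Omega>(1)]]) simp
    finally have "q ^ ?o * (card (?U \<Omega>) * q ^ (?s + ?r)) \<le> q ^ ?o * card ?C"
      by (simp only: power_add mult_ac)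
    then have le: "card (?U \<Omega>) * q ^ (?s + ?r) \<le> card ?C" using q_pos by simp
    \<comment> \<open>Destinations inside \<open>\<Omega>\<close> pay through their decoding
      equations, those outside through the cut rank.\<close>
    have "(\<Sum>\<tau>\<in>\<Theta>. d \<tau>) = ?s + (\<Sum>\<tau>\<in>\<Theta> - \<Omega>. d \<tau>)"
      by (subst sum.Int_Diff[OF fin\<Theta>, of d \<Omega>]) simp
    also have "\<dots> \<le> ?s + ?r" using cut[OF \<Omega>] by simp
    finally have "q ^ (\<Sum>\<tau>\<in>\<Theta>. d \<tau>) \<le> q ^ (?s + ?r)" using q_pos by (intro power_increasing) auto
    then show ?thesis using le by (meson le_trans mult_le_mono2)
  qed
  have fin\<O>: "finite ?\<O>" using finite_nodes by simp
  have "card (bad \<Theta> d x) \<le> card (\<Union>\<Omega>\<in>?\<O>. ?U \<Omega>)"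
    by (rule card_mono[OF _ bad_subset[OF \<Theta> d]]) (use fin\<O> finU in auto)
  also have "\<dots> \<le> (\<Sum>\<Omega>\<in>?\<O>. card (?U \<Omega>))" by (rule card_UN_le[OF fin\<O>])
  finally have "card (bad \<Theta> d x) * q ^ (\<Sum>\<tau>\<in>\<Theta>. d \<tau>) \<le> (\<Sum>\<Omega>\<in>?\<O>. card (?U \<Omega>)) * q ^ (\<Sum>\<tau>\<in>\<Theta>. d \<tau>)"
    by (rule mult_right_mono) simp
  also have "\<dots> \<le> (\<Sum>\<Omega>\<in>?\<O>. card ?C)"
    unfolding sum_distrib_right by (intro sum_mono U) auto
  also have "\<dots> = card ?\<O> * card ?C" by simp
  also have "\<dots> \<le> card (Pow (nodes G)) * card ?C"
    using finite_nodes by (intro mult_right_mono card_mono) auto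
  finally show ?thesis using finite_nodes by (simp add: card_Pow)
qed

text \<open>Badness is invariant under scaling of the source vector; this gains the factor \<open>q - 1\<close>
  over the plain union bound.\<close>
lemma card_bad_Union_le:
  assumes \<Theta>: "\<Theta> \<subseteq> nodes G - {S}" and d: "\<And>\<tau>. \<tau> \<in> \<Theta> \<Longrightarrow> d \<tau> \<le> \<mu>"
    and cut: "\<And>\<Omega>. \<Omega> \<subseteq> nodes G \<Longrightarrow> S \<in> \<Omega> \<Longrightarrow> (\<Sum>\<tau>\<in>\<Theta> - \<Omega>. d \<tau>) \<le> cut_rank TYPE('f) G \<Omega>"
    and D: "D \<subseteq> {1..\<mu>}" "card D = (\<Sum>\<tau>\<in>\<Theta>. d \<tau>)"
  defines "W \<equiv> {x \<in> {1..\<mu>} \<rightarrow>\<^sub>E L. (\<forall>i\<in>{1..\<mu>} - D. x i = 0) \<and> (\<exists>i\<in>{1..\<mu>}. x i \<noteq> 0)}"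
  shows "card (\<Union>x\<in>W. bad \<Theta> d x) * (q - 1) \<le>
    2 ^ card (nodes G) * card (\<alpha>_codes \<times> \<beta>_codes \<times> \<epsilon>_codes)"
proof -
  let ?C = "\<alpha>_codes \<times> \<beta>_codes \<times> \<epsilon>_codes"
  let ?U = "\<Union>x\<in>W. bad \<Theta> d x"
  have finD: "finite D" using D(1) finite_subset by blast
  have finW: "finite W"
    by (rule finite_subset[of _ "{1..\<mu>} \<rightarrow>\<^sub>E L"]) (use finite_L in \<open>auto simp: W_def finite_PiE\<close>)
  have finU: "finite ?U"
    by (rule finite_subset[of _ ?C]) (use finite_codes in \<open>auto simp: bad_def\<close>)
  have finX: "finite (D \<rightarrow>\<^sub>E L)" using finD finite_L by (simp add: finite_PiE)
  \<comment> \<open>Vectors of \<open>W\<close> vanish off \<open>D\<close>, so \<open>W\<close> has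
    at most \<open>q ^ card D\<close> elements; this balances the power of \<open>q\<close> in
    \<open>card_bad_le\<close>.\<close>
  have "inj_on (\<lambda>x. restrict x D) W"
  proof (rule inj_onI)
    fix x x' assume x: "x \<in> W" "x' \<in> W" and eq: "restrict x D = restrict x' D"
    have "x i = x' i" if "i \<in> {1..\<mu>}" for i
    proof (cases "i \<in> D")
      case True
      then show ?thesis using fun_cong[OF eq, of i] by simp
    next
      case False
      then show ?thesis using x that by (simp add: W_def)
    qed
    then show "x = x'" using x PiE_ext[of x "{1..\<mu>}" "\<lambda>_. L" x'] by (simp add: W_def)
  qed
  moreover have "(\<lambda>x. restrict x D) ` W \<subseteq> D \<rightarrow>\<^sub>E L"
    using D(1) by (auto simp: W_def PiE_iff)
  ultimately have "card W \<le> card (D \<rightarrow>\<^sub>E L)" using finX by (rule card_inj_on_le)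
  then have W_le: "card W \<le> q ^ (\<Sum>\<tau>\<in>\<Theta>. d \<tau>)" using finD D(2) by (simp add: card_funcsetE)
  \<comment> \<open>A code bad for \<open>x\<close> is bad for all \<open>q - 1\<close> nonzero
    multiples of \<open>x\<close>, which are distinct elements of \<open>W\<close>.\<close>
  have many: "q - 1 \<le> card {x \<in> W. p \<in> bad \<Theta> d x}" if "p \<in> ?U" for p
  proof -
    obtain x where x: "x \<in> W" "p \<in> bad \<Theta> d x" using \<open>p \<in> ?U\<close> by blast
    obtain i0 where i0: "i0 \<in> {1..\<mu>}" "x i0 \<noteq> 0" using x(1) by (auto simp: W_def)
    define f where "f t = (\<lambda>i\<in>{1..\<mu>}. t * x i)" for t
    have "inj_on f (L - {0})"
    proof (rule inj_onI)
      fix s t assume "f s = f t"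
      from fun_cong[OF this, of i0] show "s = t" using i0 by (simp add: f_def)
    qed
    moreover have "f ` (L - {0}) \<subseteq> {x \<in> W. p \<in> bad \<Theta> d x}"
    proof (rule image_subsetI, rule CollectI, rule conjI)
      fix t assume t: "t \<in> L - {0}"
      show "f t \<in> W" using x(1) t i0 unfolding W_def f_def by (auto intro!: mult_L)
      obtain a b c y where p: "p = (a, b, c)" "p \<in> ?C"
        and y: "transmission G S \<mu> (\<alpha>_of a) (\<beta>_of b) x y" "\<forall>e. y e \<in> L"
        and rec: "\<forall>\<tau>\<in>\<Theta>. \<forall>k\<in>{1..d \<tau>}. received G (\<epsilon>_of c) y \<tau> k = 0"
        using x(2) unfolding bad_def by auto
      have "transmission G S \<mu> (\<alpha>_of a) (\<beta>_of b) (f t) (\<lambda>e. t * y e)"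
        unfolding transmission_def
      proof (intro conjI ballI)
        fix V e assume V: "V \<in> nodes G" "e \<in> outports G V"
        have "(\<Sum>i=1..\<mu>. \<alpha>_of a i e * f t i) = t * (\<Sum>i=1..\<mu>. \<alpha>_of a i e * x i)"
          unfolding sum_distrib_left by (intro sum.cong) (auto simp: f_def)
        moreover have "y e = (\<Sum>e'\<in>inports G V. \<beta>_of b e' e * y e') +
            (if V = S then \<Sum>i=1..\<mu>. \<alpha>_of a i e * x i else 0)"
          using y(1) V unfolding transmission_def by blast
        ultimately show "t * y e = (\<Sum>e'\<in>inports G V. \<beta>_of b e' e * (t * y e')) +
            (if V = S then \<Sum>i=1..\<mu>. \<alpha>_of a i e * f t i else 0)"
          by (simp add: distrib_left sum_distrib_left mult_ac)
      next
        fix V e' assume V: "V \<in> nodes G" "e' \<in> inports G V"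
        then have "y e' = (\<Sum>e | (e, e') \<in> edges G. y e)" using y(1) unfolding transmission_def by blast
        then show "t * y e' = (\<Sum>e | (e, e') \<in> edges G. t * y e)" by (simp add: sum_distrib_left)
      qed
      moreover have "\<forall>e. t * y e \<in> L" using y(2) t by (auto intro: mult_L)
      moreover have "received G (\<epsilon>_of c) (\<lambda>e. t * y e) \<tau> k = t * received G (\<epsilon>_of c) y \<tau> k" for \<tau> k
        by (simp add: received_def sum_distrib_left mult_ac)
      then have "\<forall>\<tau>\<in>\<Theta>. \<forall>k\<in>{1..d \<tau>}. received G (\<epsilon>_of c) (\<lambda>e. t * y e) \<tau> k = 0"
        using rec by simp
      ultimately show "p \<in> bad \<Theta> d (f t)" using p unfolding bad_def by blast
    qed
    moreover have "finite {x \<in> W. p \<in> bad \<Theta> d x}" using finW by simp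
    ultimately have "card (L - {0}) \<le> card {x \<in> W. p \<in> bad \<Theta> d x}" by (rule card_inj_on_le)
    then show ?thesis using zero_L finite_L by simp
  qed
  let ?n = "\<Sum>\<tau>\<in>\<Theta>. d \<tau>"
  \<comment> \<open>Double counting of the pairs of a bad code and a source vector in
    \<open>W\<close> that witnesses its badness.\<close>
  have "card ?U * (q - 1) = (\<Sum>p\<in>?U. q - 1)" by simp
  also have "\<dots> \<le> (\<Sum>p\<in>?U. card {x \<in> W. p \<in> bad \<Theta> d x})" by (rule sum_mono[OF many])
  also have "\<dots> = (\<Sum>p\<in>?U. \<Sum>x\<in>W. if p \<in> bad \<Theta> d x then 1 else 0)"
    by (intro sum.cong refl) (simp add: sum.If_cases[OF finW] Int_def)
  also have "\<dots> = (\<Sum>x\<in>W. \<Sum>p\<in>?U. if p \<in> bad \<Theta> d x then 1 else 0)" by (rule sum.swap)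
  also have "\<dots> = (\<Sum>x\<in>W. card (bad \<Theta> d x))"
  proof (intro sum.cong refl)
    fix x assume "x \<in> W"
    then have "?U \<inter> {p. p \<in> bad \<Theta> d x} = bad \<Theta> d x" by blast
    then show "(\<Sum>p\<in>?U. if p \<in> bad \<Theta> d x then 1 else 0) = card (bad \<Theta> d x)"
      by (simp add: sum.If_cases[OF finU])
  qed
  finally have "card ?U * (q - 1) * q ^ ?n \<le> (\<Sum>x\<in>W. card (bad \<Theta> d x)) * q ^ ?n"
    by (rule mult_right_mono) simp
  also have "\<dots> \<le> (\<Sum>x\<in>W. 2 ^ card (nodes G) * card ?C)"
    unfolding sum_distrib_right
    by (intro sum_mono card_bad_le \<Theta> cut) (use d in \<open>auto simp: W_def\<close>)
  also have "\<dots> = card W * (2 ^ card (nodes G) * card ?C)" by simp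
  also have "\<dots> \<le> q ^ ?n * (2 ^ card (nodes G) * card ?C)" by (rule mult_right_mono[OF W_le]) simp
  finally have "q ^ ?n * (card ?U * (q - 1)) \<le> q ^ ?n * (2 ^ card (nodes G) * card ?C)"
    by (simp only: mult_ac)
  then show ?thesis using q_pos by simp
qed

end

subsection \<open>Decoding at the destinations\<close>

context finite_extension
begin

text \<open>A trivial kernel makes the linear map injective, and domain and codomain are finite sets
  of equal size, so it is onto.\<close>

lemma ex_solution:
  assumes fin: "finite I" "finite J" and card: "card I = card J"
    and M: "\<And>j i. M j i \<in> L"
    and ker: "\<And>x. (\<And>i. i \<in> I \<Longrightarrow> x i \<in> L) \<Longrightarrow> \<forall>j\<in>J. (\<Sum>i\<in>I. M j i * x i) = 0 \<Longrightarrow> \<forall>i\<in>I. x i = 0"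
    and t: "\<And>j. j \<in> J \<Longrightarrow> t j \<in> L"
  shows "\<exists>x. (\<forall>i. x i \<in> L) \<and> (\<forall>j\<in>J. (\<Sum>i\<in>I. M j i * x i) = t j)"
proof -
  define f where "f x = (\<lambda>j\<in>J. \<Sum>i\<in>I. M j i * x i)" for x
  have inj: "inj_on f (I \<rightarrow>\<^sub>E L)"
  proof (rule inj_onI)
    fix x x' assume x: "x \<in> I \<rightarrow>\<^sub>E L" and x': "x' \<in> I \<rightarrow>\<^sub>E L" and eq: "f x = f x'"
    have "(\<Sum>i\<in>I. M j i * (x i - x' i)) = 0" if "j \<in> J" for j
      using fun_cong[OF eq, of j] that by (simp add: f_def right_diff_distrib sum_subtractf)
    moreover have "x i - x' i \<in> L" if "i \<in> I" for i
      using that x x' by (auto intro: diff_L)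
    ultimately have "\<forall>i\<in>I. x i - x' i = 0" by (intro ker) auto
    then show "x = x'" using PiE_ext[OF x x'] by simp
  qed
  have "f ` (I \<rightarrow>\<^sub>E L) \<subseteq> J \<rightarrow>\<^sub>E L"
    by (rule image_subsetI) (auto simp: f_def intro!: sum_L mult_L M)
  moreover have "card (f ` (I \<rightarrow>\<^sub>E L)) = card (J \<rightarrow>\<^sub>E L)"
    using card_image[OF inj] fin card by (simp add: card_funcsetE)
  moreover have "finite (J \<rightarrow>\<^sub>E L)" using fin finite_L by (simp add: finite_PiE)
  ultimately have "f ` (I \<rightarrow>\<^sub>E L) = J \<rightarrow>\<^sub>E L" by (metis card_subset_eq)
  moreover have "restrict t J \<in> J \<rightarrow>\<^sub>E L" using t by simp
  ultimately obtain x where x: "x \<in> I \<rightarrow>\<^sub>E L" "f x = restrict t J" by (metis imageE)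
  define x' where "x' i = (if i \<in> I then x i else 0)" for i
  have "(\<Sum>i\<in>I. M j i * x' i) = t j" if "j \<in> J" for j
    using fun_cong[OF x(2), of j] that by (simp add: f_def x'_def)
  moreover have "x' i \<in> L" for i using x(1) by (auto simp: x'_def zero_L)
  ultimately show ?thesis by blast
qed

text \<open>Solving for the unit vectors gives a right inverse \<open>u\<close>. It is also a left
  inverse: applying \<open>M\<close> to the difference of \<open>u (M x)\<close> and
  \<open>x\<close> gives 0, and the kernel is trivial.\<close>

lemma ex_left_inverse:
  assumes fin: "finite I" "finite J" and card: "card I = card J"
    and M: "\<And>j i. M j i \<in> L"
    and ker: "\<And>x. (\<And>i. i \<in> I \<Longrightarrow> x i \<in> L) \<Longrightarrow> \<forall>j\<in>J. (\<Sum>i\<in>I. M j i * x i) = 0 \<Longrightarrow> \<forall>i\<in>I. x i = 0"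
  shows "\<exists>w. (\<forall>i j. w i j \<in> L) \<and>
    (\<forall>x. (\<forall>i\<in>I. x i \<in> L) \<longrightarrow> (\<forall>i\<in>I. (\<Sum>j\<in>J. w i j * (\<Sum>i'\<in>I. M j i' * x i')) = x i))"
proof -
  have "\<exists>x. (\<forall>i. x i \<in> L) \<and> (\<forall>j\<in>J. (\<Sum>i\<in>I. M j i * x i) = (if j = k then 1 else 0))" for k
    using fin card M ker by (rule ex_solution) (auto simp: zero_L one_L)
  then obtain u where u: "\<And>k i. u k i \<in> L"
    "\<And>k j. j \<in> J \<Longrightarrow> (\<Sum>i\<in>I. M j i * u k i) = (if j = k then 1 else 0)" by metis
  have "(\<Sum>j\<in>J. u j i * (\<Sum>i'\<in>I. M j i' * x i')) = x i" if x: "\<forall>i\<in>I. x i \<in> L" and i: "i \<in> I" for x i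
  proof -
    define b where "b j = (\<Sum>i'\<in>I. M j i' * x i')" for j
    define v where "v i = (\<Sum>j\<in>J. u j i * b j) - x i" for i
    have b: "b j \<in> L" for j using x by (auto simp: b_def intro!: sum_L mult_L M)
    have "(\<Sum>i\<in>I. M j i * v i) = 0" if "j \<in> J" for j
    proof -
      have "(\<Sum>i\<in>I. M j i * (\<Sum>k\<in>J. u k i * b k)) = (\<Sum>i\<in>I. \<Sum>k\<in>J. M j i * u k i * b k)"
        by (simp add: sum_distrib_left mult.assoc)
      also have "\<dots> = (\<Sum>k\<in>J. (\<Sum>i\<in>I. M j i * u k i) * b k)"
        by (subst sum.swap) (simp add: sum_distrib_right)
      also have "\<dots> = (\<Sum>k\<in>J. if k = j then b j else 0)"
        by (intro sum.cong) (auto simp: u(2)[OF that])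
      also have "\<dots> = b j" using that fin(2) by simp
      finally show ?thesis by (simp add: v_def right_diff_distrib sum_subtractf b_def)
    qed
    moreover have "v i \<in> L" if "i \<in> I" for i
      using x that unfolding v_def by (auto intro!: diff_L sum_L mult_L u b)
    ultimately have "\<forall>i\<in>I. v i = 0" by (intro ker) auto
    then show ?thesis using i by (simp add: v_def b_def)
  qed
  then show ?thesis using u(1) by (intro exI[of _ "\<lambda>i j. u j i"]) blast
qed

end

section \<open>From a good random code to a code that serves every destination\<close>

context coded_network
begin

text \<open>\<open>R\<close> indexes requirements that one code has to meet together: for each
  \<open>r\<close>, the destinations \<open>\<Theta> r\<close> jointly see no nonzero source vector
  supported on \<open>D r\<close> as zero. Each requirement excludes at most a fraction
  \<open>2 ^ card (nodes G) / (q - 1)\<close> of the codes, so a union bound applies.\<close>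

lemma ex_good_codes:
  fixes R :: "'r set"
  assumes finR: "finite R" and large: "card R * 2 ^ card (nodes G) + 1 < q"
    and \<Theta>: "\<And>r. r \<in> R \<Longrightarrow> \<Theta> r \<subseteq> nodes G - {S}"
    and d: "\<And>r \<tau>. r \<in> R \<Longrightarrow> \<tau> \<in> \<Theta> r \<Longrightarrow> d r \<tau> \<le> \<mu>"
    and cut: "\<And>r \<Omega>. r \<in> R \<Longrightarrow> \<Omega> \<subseteq> nodes G \<Longrightarrow> S \<in> \<Omega> \<Longrightarrow>
      (\<Sum>\<tau>\<in>\<Theta> r - \<Omega>. d r \<tau>) \<le> cut_rank TYPE('f) G \<Omega>"
    and D: "\<And>r. r \<in> R \<Longrightarrow> D r \<subseteq> {1..\<mu>}" "\<And>r. r \<in> R \<Longrightarrow> card (D r) = (\<Sum>\<tau>\<in>\<Theta> r. d r \<tau>)"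
  shows "\<exists>\<alpha> \<beta> \<epsilon> H. (\<forall>i e. \<alpha> i e \<in> L) \<and> (\<forall>e' e. \<beta> e' e \<in> L) \<and> (\<forall>e' V k. \<epsilon> e' V k \<in> L) \<and>
    (\<forall>i e. H i e \<in> L) \<and> (\<forall>x. transmission G S \<mu> \<alpha> \<beta> x (\<lambda>e. \<Sum>i=1..\<mu>. x i * H i e)) \<and>
    (\<forall>r\<in>R. \<forall>x. (\<forall>i\<in>{1..\<mu>}. x i \<in> L) \<longrightarrow> (\<forall>i\<in>{1..\<mu>} - D r. x i = 0) \<longrightarrow>
      (\<forall>\<tau>\<in>\<Theta> r. \<forall>k\<in>{1..d r \<tau>}. (\<Sum>i=1..\<mu>. received G \<epsilon> (H i) \<tau> k * x i) = 0) \<longrightarrow>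
      (\<forall>i\<in>{1..\<mu>}. x i = 0))"
proof -
  let ?C = "\<alpha>_codes \<times> \<beta>_codes \<times> \<epsilon>_codes"
  define W where "W r = {x \<in> {1..\<mu>} \<rightarrow>\<^sub>E L. (\<forall>i\<in>{1..\<mu>} - D r. x i = 0) \<and> (\<exists>i\<in>{1..\<mu>}. x i \<noteq> 0)}" for r
  define B where "B = (\<Union>r\<in>R. \<Union>x\<in>W r. bad (\<Theta> r) (d r) x)"
  have "card B * (q - 1) \<le> (\<Sum>r\<in>R. card (\<Union>x\<in>W r. bad (\<Theta> r) (d r) x)) * (q - 1)"
    unfolding B_def by (rule mult_right_mono[OF card_UN_le[OF finR]]) simp
  also have "\<dots> \<le> (\<Sum>r\<in>R. 2 ^ card (nodes G) * card ?C)"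
    unfolding sum_distrib_right W_def
    by (intro sum_mono card_bad_Union_le \<Theta> D cut) (use d in auto)
  finally have le: "card B * (q - 1) \<le> card R * 2 ^ card (nodes G) * card ?C" by simp
  have "\<alpha>_codes \<noteq> {}" "\<beta>_codes \<noteq> {}" "\<epsilon>_codes \<noteq> {}"
    using zero_L by (auto simp: \<alpha>_codes_def \<beta>_codes_def \<epsilon>_codes_def PiE_eq_empty_iff)
  then have "card ?C > 0" using finite_codes by (simp add: card_gt_0_iff)
  \<comment> \<open>\<open>large\<close> keeps the union bound below \<open>q - 1\<close>, so the
    bad codes cannot exhaust all codes.\<close>
  then have less: "card R * 2 ^ card (nodes G) * card ?C < card ?C * (q - 1)"
    using large by (simp add: mult.commute)
  have "B \<noteq> ?C" using le less by auto
  moreover have "B \<subseteq> ?C" by (auto simp: B_def bad_def)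
  ultimately obtain a b c where abc: "(a, b, c) \<in> ?C" "(a, b, c) \<notin> B" by auto
  have codes: "\<alpha>_of a i e \<in> L" "\<beta>_of b e' e \<in> L" "\<epsilon>_of c e' V k \<in> L" for i e e' V k
    using abc(1) codes_L by auto
  have "\<exists>y. transmission G S \<mu> (\<alpha>_of a) (\<beta>_of b) (\<lambda>j. if j = i then 1 else 0) y \<and> (\<forall>e. y e \<in> L)" for i
    by (rule ex_transmission) (auto simp: codes zero_L one_L)
  then obtain H where H: "\<And>i. transmission G S \<mu> (\<alpha>_of a) (\<beta>_of b) (\<lambda>j. if j = i then 1 else 0) (H i)"
    "\<And>i e. H i e \<in> L" by metis
  have trans: "transmission G S \<mu> (\<alpha>_of a) (\<beta>_of b) x (\<lambda>e. \<Sum>i=1..\<mu>. x i * H i e)" for x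
    by (rule transmission_linear_combination) (rule H)
  have "\<forall>i\<in>{1..\<mu>}. x i = 0"
    if r: "r \<in> R" and x: "\<forall>i\<in>{1..\<mu>}. x i \<in> L" "\<forall>i\<in>{1..\<mu>} - D r. x i = 0"
      and zero: "\<forall>\<tau>\<in>\<Theta> r. \<forall>k\<in>{1..d r \<tau>}. (\<Sum>i=1..\<mu>. received G (\<epsilon>_of c) (H i) \<tau> k * x i) = 0" for r x
  proof (rule ccontr)
    assume nz: "\<not> (\<forall>i\<in>{1..\<mu>}. x i = 0)"
    define x' where "x' = restrict x {1..\<mu>}"
    define y where "y e = (\<Sum>i=1..\<mu>. x' i * H i e)" for e
    have "x' \<in> W r" using x nz by (auto simp: W_def x'_def)
    moreover have "(a, b, c) \<in> bad (\<Theta> r) (d r) x'"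
    proof -
      have "transmission G S \<mu> (\<alpha>_of a) (\<beta>_of b) x' y"
        using trans[of x'] by (simp add: y_def[abs_def])
      moreover have "y e \<in> L" for e
        using x(1) by (auto simp: y_def x'_def intro!: sum_L mult_L H(2))
      moreover have "received G (\<epsilon>_of c) y \<tau> k = (\<Sum>i=1..\<mu>. received G (\<epsilon>_of c) (H i) \<tau> k * x i)" for \<tau> k
      proof -
        have "received G (\<epsilon>_of c) y \<tau> k = (\<Sum>e'\<in>inports G \<tau>. \<Sum>i=1..\<mu>. \<epsilon>_of c e' \<tau> k * H i e' * x i)"
          by (simp add: received_def y_def sum_distrib_left x'_def mult_ac)
        also have "\<dots> = (\<Sum>i=1..\<mu>. received G (\<epsilon>_of c) (H i) \<tau> k * x i)"
          by (subst sum.swap) (simp add: received_def sum_distrib_right)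
        finally show ?thesis .
      qed
      ultimately show ?thesis using zero abc(1) unfolding bad_def by auto
    qed
    ultimately show False using abc(2) r by (auto simp: B_def)
  qed
  then show ?thesis using codes H(2) trans by blast
qed

text \<open>A good code only provides trivial kernels. A disjoint multicast destination cannot
  remove interference from the other processes on its own, so the source precodes to make the joint
  transfer matrix select the demanded processes. Each full multicast destination then inverts its
  transfer matrix composed with the precoder.\<close>

lemma sufficient_cuts_imp_code:
  assumes large: "(N + 1) * 2 ^ card (nodes G) + 1 < q"
    and T: "T ` {1..N} \<subseteq> nodes G - {S}" "inj_on T {1..N}" and KN: "K \<le> N"
    and D: "\<And>i. i \<in> {1..K} \<Longrightarrow> D i \<subseteq> {1..\<mu>}"
      "\<And>i j. i \<in> {1..K} \<Longrightarrow> j \<in> {1..K} \<Longrightarrow> i \<noteq> j \<Longrightarrow> D i \<inter> D j = {}"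
    and cut: "\<And>\<Omega>. \<Omega> \<subseteq> nodes G \<Longrightarrow> S \<in> \<Omega> \<Longrightarrow>
        (\<Sum>i | i \<in> {1..K} \<and> T i \<notin> \<Omega>. card (D i)) \<le> cut_rank TYPE('f) G \<Omega>"
      "\<And>j \<Omega>. j \<in> {K+1..N} \<Longrightarrow> \<Omega> \<subseteq> nodes G \<Longrightarrow> S \<in> \<Omega> \<Longrightarrow> T j \<notin> \<Omega> \<Longrightarrow> \<mu> \<le> cut_rank TYPE('f) G \<Omega>"
  shows "\<exists>\<alpha> \<beta> \<epsilon> y. (\<forall>i e. \<alpha> i e \<in> L) \<and> (\<forall>e' e. \<beta> e' e \<in> L) \<and> (\<forall>e' V k. \<epsilon> e' V k \<in> L) \<and>
    (\<forall>x \<in> {1..\<mu>} \<rightarrow>\<^sub>E L. transmission G S \<mu> \<alpha> \<beta> x (y x)) \<and>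
    (\<forall>i\<in>{1..K}. \<forall>m\<in>D i. \<exists>k\<in>{1..\<mu>}. \<forall>x \<in> {1..\<mu>} \<rightarrow>\<^sub>E L. received G \<epsilon> (y x) (T i) k = x m) \<and>
    (\<forall>i\<in>{K+1..N}. \<forall>m\<in>{1..\<mu>}. \<forall>x \<in> {1..\<mu>} \<rightarrow>\<^sub>E L. received G \<epsilon> (y x) (T i) m = x m)"
proof -
  \<comment> \<open>Demands are indexed by numbers, but \<open>d\<close> must be a function of the
    node.\<close>
  define idx where "idx = the_inv_into {1..N} T"
  have idx: "idx (T i) = i" if "i \<in> {1..N}" for i
    unfolding idx_def by (rule the_inv_into_f_f[OF T(2) that])
  \<comment> \<open>Destinations are numbered from 1, so 0 is free to name the joint requirement on
    the disjoint multicast destinations.\<close>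
  define R where "R = insert 0 {K+1..N}"
  define \<Theta> where "\<Theta> r = (if r = 0 then T ` {1..K} else {T r})" for r
  define d where "d r \<tau> = (if r = 0 then card (D (idx \<tau>)) else \<mu>)" for r :: nat and \<tau>
  define D0 where "D0 = (\<Union>i\<in>{1..K}. D i)"
  define D' where "D' r = (if r = 0 then D0 else {1..\<mu>})" for r :: nat
  have D0: "D0 \<subseteq> {1..\<mu>}" unfolding D0_def using D(1) by blast
  have finD: "finite (D i)" if "i \<in> {1..K}" for i using D(1)[OF that] finite_subset by blast
  have injK: "inj_on T {1..K}" using T(2) KN by (auto intro: inj_on_subset)
  have cardD0: "card D0 = (\<Sum>i\<in>{1..K}. card (D i))"
    unfolding D0_def by (rule card_UN_disjoint) (use D(2) finD in auto)
  have cardD: "card (D i) \<le> \<mu>" if "i \<in> {1..K}" for i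
    using card_mono[OF _ D(1)[OF that]] by simp
  have sum_d: "(\<Sum>\<tau>\<in>T ` A. d 0 \<tau>) = (\<Sum>i\<in>A. card (D i))" if "A \<subseteq> {1..K}" for A
  proof -
    have "(\<Sum>\<tau>\<in>T ` A. d 0 \<tau>) = (\<Sum>i\<in>A. d 0 (T i))"
      using inj_on_subset[OF injK that] by (simp add: sum.reindex)
    also have "\<dots> = (\<Sum>i\<in>A. card (D i))"
      using that KN by (intro sum.cong) (auto simp: d_def idx subset_iff)
    finally show ?thesis .
  qed
  have "\<exists>\<alpha> \<beta> \<epsilon> H. (\<forall>i e. \<alpha> i e \<in> L) \<and> (\<forall>e' e. \<beta> e' e \<in> L) \<and> (\<forall>e' V k. \<epsilon> e' V k \<in> L) \<and>
    (\<forall>i e. H i e \<in> L) \<and> (\<forall>x. transmission G S \<mu> \<alpha> \<beta> x (\<lambda>e. \<Sum>i=1..\<mu>. x i * H i e)) \<and>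
    (\<forall>r\<in>R. \<forall>x. (\<forall>i\<in>{1..\<mu>}. x i \<in> L) \<longrightarrow> (\<forall>i\<in>{1..\<mu>} - D' r. x i = 0) \<longrightarrow>
      (\<forall>\<tau>\<in>\<Theta> r. \<forall>k\<in>{1..d r \<tau>}. (\<Sum>i=1..\<mu>. received G \<epsilon> (H i) \<tau> k * x i) = 0) \<longrightarrow>
      (\<forall>i\<in>{1..\<mu>}. x i = 0))"
  proof (rule ex_good_codes)
    show "finite R" by (simp add: R_def)
    have "card R \<le> Suc (card {K+1..N})" unfolding R_def by (rule card_insert_le_m1) simp_all
    then have "card R * 2 ^ card (nodes G) \<le> (N + 1) * 2 ^ card (nodes G)"
      by (intro mult_right_mono) auto
    then show "card R * 2 ^ card (nodes G) + 1 < q" using large by linarith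
    show "\<Theta> r \<subseteq> nodes G - {S}" if "r \<in> R" for r
    proof -
      have "\<Theta> r \<subseteq> T ` {1..N}"
        using that KN by (cases "r = 0") (auto simp: R_def \<Theta>_def)
      then show ?thesis using T(1) by blast
    qed
    show "d r \<tau> \<le> \<mu>" if "r \<in> R" and \<tau>: "\<tau> \<in> \<Theta> r" for r \<tau>
    proof (cases "r = 0")
      case True
      then obtain i where i: "i \<in> {1..K}" "\<tau> = T i" using \<tau> by (auto simp: \<Theta>_def)
      then have "i \<in> {1..N}" using KN by simp
      then show ?thesis using cardD[OF i(1)] by (simp add: d_def idx i(2))
    qed (simp add: d_def)
    show "D' r \<subseteq> {1..\<mu>}" for r using D0 by (simp add: D'_def)
    show "card (D' r) = (\<Sum>\<tau>\<in>\<Theta> r. d r \<tau>)" for r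
      using sum_d[OF subset_refl] by (cases "r = 0") (simp_all add: D'_def \<Theta>_def cardD0 d_def)
    show "(\<Sum>\<tau>\<in>\<Theta> r - \<Omega>. d r \<tau>) \<le> cut_rank TYPE('f) G \<Omega>"
      if "r \<in> R" and \<Omega>: "\<Omega> \<subseteq> nodes G" "S \<in> \<Omega>" for r \<Omega>
    proof (cases "r = 0")
      case True
      let ?A = "{i. i \<in> {1..K} \<and> T i \<notin> \<Omega>}"
      have \<Theta>0: "\<Theta> 0 - \<Omega> = T ` ?A" by (auto simp: \<Theta>_def)
      have "?A \<subseteq> {1..K}" by blast
      from sum_d[OF this] show ?thesis unfolding True \<Theta>0 using cut(1)[OF \<Omega>] by (simp only:)
    next
      case False
      have "\<Theta> r - \<Omega> = (if T r \<in> \<Omega> then {} else {T r})" using False by (auto simp: \<Theta>_def)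
      then show ?thesis using that(1) False cut(2)[of r, OF _ \<Omega>] by (auto simp: d_def R_def)
    qed
  qed
  then obtain \<alpha> \<beta> \<epsilon> H where codes: "\<forall>i e. \<alpha> i e \<in> L" "\<forall>e' e. \<beta> e' e \<in> L"
      "\<forall>e' V k. \<epsilon> e' V k \<in> L" "\<forall>i e. H i e \<in> L"
    and trans: "\<forall>x. transmission G S \<mu> \<alpha> \<beta> x (\<lambda>e. \<Sum>i=1..\<mu>. x i * H i e)"
    and good: "\<forall>r\<in>R. \<forall>x. (\<forall>i\<in>{1..\<mu>}. x i \<in> L) \<longrightarrow> (\<forall>i\<in>{1..\<mu>} - D' r. x i = 0) \<longrightarrow>
      (\<forall>\<tau>\<in>\<Theta> r. \<forall>k\<in>{1..d r \<tau>}. (\<Sum>i=1..\<mu>. received G \<epsilon> (H i) \<tau> k * x i) = 0) \<longrightarrow>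
      (\<forall>i\<in>{1..\<mu>}. x i = 0)"
    by - (elim exE conjE, (rule that; assumption))
  note \<alpha> = codes(1)[rule_format] and \<beta> = codes(2)[rule_format]
    and \<epsilon> = codes(3)[rule_format] and H = codes(4)[rule_format]
  note trans = trans[rule_format]
  have good: "\<forall>i\<in>{1..\<mu>}. x i = 0" if "r \<in> R" "\<forall>i\<in>{1..\<mu>}. x i \<in> L" "\<forall>i\<in>{1..\<mu>} - D' r. x i = 0"
    "\<forall>\<tau>\<in>\<Theta> r. \<forall>k\<in>{1..d r \<tau>}. (\<Sum>i=1..\<mu>. received G \<epsilon> (H i) \<tau> k * x i) = 0" for r x
    using bspec[OF good that(1)] that(2-4) by blast
  define \<rho> where "\<rho> V k i = received G \<epsilon> (H i) V k" for V k i
  have \<rho>: "\<rho> V k i \<in> L" for V k i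
    unfolding \<rho>_def received_def by (intro sum_L mult_L \<epsilon> H)
  have "\<exists>g. bij_betw g {1..card (D i)} (D i)" if "i \<in> {1..K}" for i
    using ex_bij_betw_nat_finite_1[OF finD[OF that]] .
  then obtain g where g: "\<And>i. i \<in> {1..K} \<Longrightarrow> bij_betw (g i) {1..card (D i)} (D i)" by metis
  \<comment> \<open>A pair \<open>(i, k)\<close> stands for component \<open>k\<close> at
    \<open>T i\<close>, which is to carry the process \<open>g i k\<close>. Disjointness of the
    demands gives \<open>card J = card D0\<close>, so the systems below are square.\<close>
  define J where "J = Sigma {1..K} (\<lambda>i. {1..card (D i)})"
  have J: "finite J" "card D0 = card J" by (simp_all add: J_def cardD0)
  have finD0: "finite D0" using D0 finite_subset by blast
  have g_D0: "g (fst p) (snd p) \<in> D0" if "p \<in> J" for p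
  proof -
    have f: "fst p \<in> {1..K}" "snd p \<in> {1..card (D (fst p))}" using that by (auto simp: J_def)
    then show ?thesis using bij_betwE[OF g[OF f(1)]] unfolding D0_def by blast
  qed
  have split: "(\<Sum>l=1..\<mu>. f l) = (\<Sum>l\<in>D0. f l) + (\<Sum>l\<in>{1..\<mu>} - D0. f l)" for f :: "nat \<Rightarrow> 'k"
    using sum.subset_diff[OF D0 finite_atLeastAtMost, of f] by (simp only: add.commute)
  \<comment> \<open>\<open>p\<close> is the precoding vector of process \<open>m\<close>: the
    identity on processes nobody in the disjoint part demands, and on \<open>D0\<close> a correction
    chosen so that process \<open>m\<close> shows up exactly in the components meant for it.\<close>
  have ex_P: "\<forall>m. \<exists>p. (\<forall>l. p l \<in> L) \<and> (\<forall>l. l \<notin> D0 \<longrightarrow> p l = (if l = m then 1 else 0)) \<and>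
    (\<forall>s\<in>J. (\<Sum>l=1..\<mu>. \<rho> (T (fst s)) (snd s) l * p l) = (if g (fst s) (snd s) = m then 1 else 0))"
  proof (rule allI, goal_cases)
    case (1 m)
    \<comment> \<open>The subtracted term cancels the interference that an undemanded process
      \<open>m\<close> causes through its own coordinate.\<close>
    define t where "t s = (if g (fst s) (snd s) = m then 1 else 0) -
      (if m \<in> {1..\<mu>} - D0 then \<rho> (T (fst s)) (snd s) m else 0)" for s
    have "\<exists>x. (\<forall>i. x i \<in> L) \<and> (\<forall>s\<in>J. (\<Sum>l\<in>D0. \<rho> (T (fst s)) (snd s) l * x l) = t s)"
    proof (rule ex_solution[OF finD0 J(1,2)])
      show "t s \<in> L" for s unfolding t_def by (rule diff_L) (auto simp: zero_L one_L \<rho>)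
      fix x assume x: "\<And>i. i \<in> D0 \<Longrightarrow> x i \<in> L"
        and eq: "\<forall>s\<in>J. (\<Sum>l\<in>D0. \<rho> (T (fst s)) (snd s) l * x l) = 0"
      define x' where "x' i = (if i \<in> D0 then x i else 0)" for i
      have x'_zero: "\<forall>i\<in>{1..\<mu>}. x' i = 0"
      proof (rule good[of 0])
        show "\<forall>\<tau>\<in>\<Theta> 0. \<forall>k\<in>{1..d 0 \<tau>}. (\<Sum>i=1..\<mu>. received G \<epsilon> (H i) \<tau> k * x' i) = 0"
        proof (intro ballI)
          fix \<tau> k assume "\<tau> \<in> \<Theta> 0" "k \<in> {1..d 0 \<tau>}"
          then obtain i where i: "i \<in> {1..K}" "\<tau> = T i" "(i, k) \<in> J"
            using KN by (auto simp: \<Theta>_def d_def idx J_def)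
          have "(\<Sum>i=1..\<mu>. received G \<epsilon> (H i) \<tau> k * x' i) = (\<Sum>l\<in>D0. \<rho> (T i) k l * x l)"
            unfolding split by (simp add: x'_def \<rho>_def i(2))
          then show "(\<Sum>i=1..\<mu>. received G \<epsilon> (H i) \<tau> k * x' i) = 0"
            using bspec[OF eq i(3)] by simp
        qed
      qed (use x in \<open>auto simp: R_def x'_def D'_def zero_L\<close>)
      show "\<forall>i\<in>D0. x i = 0"
      proof
        fix i assume i: "i \<in> D0"
        then have "x' i = 0" using x'_zero D0 by blast
        then show "x i = 0" using i by (simp add: x'_def)
      qed
    qed (rule \<rho>)
    then obtain x where x: "\<And>i. x i \<in> L"
      "\<And>s. s \<in> J \<Longrightarrow> (\<Sum>l\<in>D0. \<rho> (T (fst s)) (snd s) l * x l) = t s" by blast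
    define p where "p l = (if l \<in> D0 then x l else if l = m then 1 else 0)" for l
    have rest: "(\<Sum>l\<in>{1..\<mu>} - D0. f l * p l) = (if m \<in> {1..\<mu>} - D0 then f m else 0)" for f
    proof -
      have "(\<Sum>l\<in>{1..\<mu>} - D0. f l * p l) = (\<Sum>l\<in>{1..\<mu>} - D0. if l = m then f m else 0)"
        by (intro sum.cong) (auto simp: p_def)
      then show ?thesis by simp
    qed
    have "(\<Sum>l=1..\<mu>. \<rho> (T (fst s)) (snd s) l * p l) = (if g (fst s) (snd s) = m then 1 else 0)"
      if "s \<in> J" for s
      unfolding split rest using x(2)[OF that] by (simp add: p_def t_def)
    then show ?case using x(1) by (intro exI[of _ p]) (auto simp: p_def zero_L one_L)
  qed
  obtain P where P': "\<forall>m. (\<forall>l. P m l \<in> L) \<and> (\<forall>l. l \<notin> D0 \<longrightarrow> P m l = (if l = m then 1 else 0)) \<and>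
    (\<forall>s\<in>J. (\<Sum>l=1..\<mu>. \<rho> (T (fst s)) (snd s) l * P m l) = (if g (fst s) (snd s) = m then 1 else 0))"
    using choice[OF ex_P] by (elim exE) (rule that)
  have P: "P m l \<in> L" "l \<notin> D0 \<Longrightarrow> P m l = (if l = m then 1 else 0)"
    "s \<in> J \<Longrightarrow> (\<Sum>l=1..\<mu>. \<rho> (T (fst s)) (snd s) l * P m l) = (if g (fst s) (snd s) = m then 1 else 0)"
    for m l s using spec[OF P', of m] by blast+
  define pre where "pre x l = (\<Sum>m=1..\<mu>. P m l * x m)" for x l
  have pre_L: "pre x l \<in> L" if "\<forall>m\<in>{1..\<mu>}. x m \<in> L" for x l
    using that by (auto simp: pre_def intro!: sum_L mult_L P(1))
  have pull: "(\<Sum>l=1..\<mu>. f l * pre x l) = (\<Sum>m=1..\<mu>. (\<Sum>l=1..\<mu>. f l * P m l) * x m)" for f x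
  proof -
    have "(\<Sum>l=1..\<mu>. f l * pre x l) = (\<Sum>l=1..\<mu>. \<Sum>m=1..\<mu>. f l * P m l * x m)"
      by (simp add: pre_def sum_distrib_left mult.assoc)
    also have "\<dots> = (\<Sum>m=1..\<mu>. (\<Sum>l=1..\<mu>. f l * P m l) * x m)"
      by (subst sum.swap) (simp add: sum_distrib_right)
    finally show ?thesis .
  qed
  have decode: "(\<Sum>l=1..\<mu>. \<rho> (T i) k l * pre x l) = x (g i k)" if "(i, k) \<in> J" for i k x
  proof -
    have "(\<Sum>l=1..\<mu>. \<rho> (T i) k l * pre x l) = (\<Sum>m=1..\<mu>. if m = g i k then x (g i k) else 0)"
      unfolding pull using P(3)[OF that] by (intro sum.cong) auto
    also have "\<dots> = x (g i k)" using g_D0[OF that] D0 by (auto simp: subset_iff)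
    finally show ?thesis .
  qed
  \<comment> \<open>Precoding is injective: the processes in \<open>D0\<close> can be recovered
    through \<open>decode\<close>, the others pass unchanged. Without this the full multicast
    destinations could not decode.\<close>
  have pre_inj: "\<forall>m\<in>{1..\<mu>}. x m = 0" if zero: "\<forall>l\<in>{1..\<mu>}. pre x l = 0" for x
  proof
    fix m assume m: "m \<in> {1..\<mu>}"
    show "x m = 0"
    proof (cases "m \<in> D0")
      case True
      then obtain i where i: "i \<in> {1..K}" "m \<in> D i" by (auto simp: D0_def)
      have "m \<in> g i ` {1..card (D i)}"
        unfolding bij_betw_imp_surj_on[OF g[OF i(1)]] by (rule i(2))
      then obtain k where k: "k \<in> {1..card (D i)}" "g i k = m" by blast
      then have "(i, k) \<in> J" using i by (simp add: J_def)
      from decode[OF this, of x] show ?thesis using zero k by simp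
    next
      case False
      have "pre x m = (\<Sum>m'=1..\<mu>. if m' = m then x m else 0)"
        unfolding pre_def by (intro sum.cong) (auto simp: P(2)[OF False])
      then show ?thesis using zero m by simp
    qed
  qed
  \<comment> \<open>At a full multicast destination a kernel vector of the composed matrix is sent
    to 0 by the precoder, by \<open>good\<close>, and is then 0 by \<open>pre_inj\<close>; hence a
    left inverse exists.\<close>
  have ex_w: "\<forall>V\<in>T ` {K+1..N}. \<exists>w. (\<forall>m k. w m k \<in> L) \<and> (\<forall>x. (\<forall>m\<in>{1..\<mu>}. x m \<in> L) \<longrightarrow>
    (\<forall>m\<in>{1..\<mu>}. (\<Sum>k=1..\<mu>. w m k * (\<Sum>m'=1..\<mu>. (\<Sum>l=1..\<mu>. \<rho> V k l * P m' l) * x m')) = x m))"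
  proof (rule ballI, goal_cases)
    case (1 V)
    then obtain j where j: "j \<in> {K+1..N}" "V = T j" by blast
    show ?case
    proof (rule ex_left_inverse)
      fix x assume x: "\<And>i. i \<in> {1..\<mu>} \<Longrightarrow> x i \<in> L"
        and eq: "\<forall>k\<in>{1..\<mu>}. (\<Sum>m'=1..\<mu>. (\<Sum>l=1..\<mu>. \<rho> V k l * P m' l) * x m') = 0"
      have "\<forall>l\<in>{1..\<mu>}. pre x l = 0"
      proof (rule good[of j])
        show "\<forall>\<tau>\<in>\<Theta> j. \<forall>k\<in>{1..d j \<tau>}. (\<Sum>i=1..\<mu>. received G \<epsilon> (H i) \<tau> k * pre x i) = 0"
          using eq[folded pull] j by (simp add: \<Theta>_def d_def \<rho>_def)
      qed (use j x in \<open>auto simp: R_def D'_def intro!: pre_L\<close>)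
      then show "\<forall>i\<in>{1..\<mu>}. x i = 0" by (rule pre_inj)
    qed (auto intro!: sum_L mult_L \<rho> P)
  qed
  obtain w where w': "\<forall>V\<in>T ` {K+1..N}. (\<forall>m k. w V m k \<in> L) \<and> (\<forall>x. (\<forall>m\<in>{1..\<mu>}. x m \<in> L) \<longrightarrow>
    (\<forall>m\<in>{1..\<mu>}. (\<Sum>k=1..\<mu>. w V m k * (\<Sum>m'=1..\<mu>. (\<Sum>l=1..\<mu>. \<rho> V k l * P m' l) * x m')) = x m))"
    using bchoice[OF ex_w] by (elim exE) (rule that)
  have w: "\<And>V m k. V \<in> T ` {K+1..N} \<Longrightarrow> w V m k \<in> L"
    "\<And>V x m. V \<in> T ` {K+1..N} \<Longrightarrow> \<forall>m\<in>{1..\<mu>}. x m \<in> L \<Longrightarrow> m \<in> {1..\<mu>} \<Longrightarrow>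
      (\<Sum>k=1..\<mu>. w V m k * (\<Sum>l=1..\<mu>. \<rho> V k l * pre x l)) = x m"
    unfolding pull using w' by blast+
  \<comment> \<open>The precoder is absorbed into the source coefficients and the left inverses into
    the decoding coefficients, so the result is again an ordinary linear code. Injectivity of
    \<open>T\<close> keeps the new decoders away from the disjoint multicast destinations.\<close>
  define \<alpha>' where "\<alpha>' m e = (\<Sum>l=1..\<mu>. \<alpha> l e * P m l)" for m e
  define \<epsilon>' where "\<epsilon>' e' V k = (if V \<in> T ` {K+1..N} then \<Sum>k'=1..\<mu>. w V k k' * \<epsilon> e' V k' else \<epsilon> e' V k)"
    for e' V k
  define y where "y x e = (\<Sum>l=1..\<mu>. pre x l * H l e)" for x e
  have rec: "received G \<epsilon> (y x) V k = (\<Sum>l=1..\<mu>. \<rho> V k l * pre x l)" for x V k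
  proof -
    have "received G \<epsilon> (y x) V k = (\<Sum>e'\<in>inports G V. \<Sum>l=1..\<mu>. \<epsilon> e' V k * H l e' * pre x l)"
      by (simp add: received_def y_def sum_distrib_left mult_ac)
    also have "\<dots> = (\<Sum>l=1..\<mu>. \<rho> V k l * pre x l)"
      by (subst sum.swap) (simp add: received_def \<rho>_def sum_distrib_right)
    finally show ?thesis .
  qed
  have trans': "transmission G S \<mu> \<alpha>' \<beta> x (y x)" for x
    using trans[of "pre x"] unfolding transmission_def \<alpha>'_def y_def[abs_def] pull .
  have disjoint: "\<exists>k\<in>{1..\<mu>}. \<forall>x \<in> {1..\<mu>} \<rightarrow>\<^sub>E L. received G \<epsilon>' (y x) (T i) k = x m"
    if i: "i \<in> {1..K}" and m: "m \<in> D i" for i m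
  proof -
    have "m \<in> g i ` {1..card (D i)}"
      unfolding bij_betw_imp_surj_on[OF g[OF i]] by (rule m)
    then obtain k where k: "k \<in> {1..card (D i)}" "g i k = m" by blast
    have "T i \<notin> T ` {K+1..N}"
    proof
      assume "T i \<in> T ` {K+1..N}"
      then obtain j where j: "j \<in> {K+1..N}" "T i = T j" by blast
      then have "i = j" using idx[of i] idx[of j] i KN by simp
      then show False using i j by simp
    qed
    then have "received G \<epsilon>' (y x) (T i) k = received G \<epsilon> (y x) (T i) k" for x
      by (simp add: received_def \<epsilon>'_def)
    moreover have "(i, k) \<in> J" using i k by (simp add: J_def)
    ultimately have "received G \<epsilon>' (y x) (T i) k = x m" for x
      using decode k(2) by (simp add: rec)
    moreover have "k \<in> {1..\<mu>}" using k(1) cardD[OF i] by simp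
    ultimately show ?thesis by blast
  qed
  have multi: "received G \<epsilon>' (y x) (T i) m = x m"
    if i: "i \<in> {K+1..N}" and m: "m \<in> {1..\<mu>}" and x: "x \<in> {1..\<mu>} \<rightarrow>\<^sub>E L" for i m x
  proof -
    have Ti: "T i \<in> T ` {K+1..N}" using i by blast
    have "received G \<epsilon>' (y x) (T i) m =
      (\<Sum>e'\<in>inports G (T i). \<Sum>k=1..\<mu>. w (T i) m k * (\<epsilon> e' (T i) k * y x e'))"
      using Ti by (simp add: received_def \<epsilon>'_def sum_distrib_right mult.assoc)
    also have "\<dots> = (\<Sum>k=1..\<mu>. w (T i) m k * received G \<epsilon> (y x) (T i) k)"
      by (subst sum.swap) (simp add: received_def sum_distrib_left)
    also have "\<dots> = x m" unfolding rec by (rule w(2)[OF Ti _ m]) (use x in auto)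
    finally show ?thesis .
  qed
  have \<alpha>'_L: "\<alpha>' i e \<in> L" for i e unfolding \<alpha>'_def by (intro sum_L mult_L \<alpha> P(1))
  have \<epsilon>'_L: "\<epsilon>' e' V k \<in> L" for e' V k unfolding \<epsilon>'_def by (auto intro!: sum_L mult_L \<epsilon> w(1))
  show ?thesis
    by (intro exI[of _ \<alpha>'] exI[of _ \<beta>] exI[of _ \<epsilon>'] exI[of _ y] conjI)
      (use \<alpha>'_L \<beta> \<epsilon>'_L trans' disjoint multi in blast)+
qed

end

section \<open>Min-cut conditions and the equivalence\<close>

text \<open>The minimum ranges over finitely many cuts, and the complement of \<open>\<T>\<close> is
  one of them, so a lower bound on it is a bound for every cut.\<close>

lemma le_min_cut_iff:
  assumes "is_network G" "S \<in> nodes G" "\<T> \<subseteq> nodes G" "S \<notin> \<T>"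
  shows "n \<le> min_cut F G S \<T> \<longleftrightarrow>
    (\<forall>\<Omega>. \<Omega> \<subseteq> nodes G \<longrightarrow> S \<in> \<Omega> \<longrightarrow> \<T> \<inter> \<Omega> = {} \<longrightarrow> n \<le> cut_rank F G \<Omega>)"
proof -
  have "finite (nodes G)" using assms(1) by (simp add: is_network_def)
  then have fin: "finite (cut_rank F G ` {\<Omega>. \<Omega> \<subseteq> nodes G \<and> S \<in> \<Omega> \<and> \<T> \<subseteq> nodes G - \<Omega>})"
    by simp
  have "nodes G - \<T> \<in> {\<Omega>. \<Omega> \<subseteq> nodes G \<and> S \<in> \<Omega> \<and> \<T> \<subseteq> nodes G - \<Omega>}" using assms by auto
  then have ne: "cut_rank F G ` {\<Omega>. \<Omega> \<subseteq> nodes G \<and> S \<in> \<Omega> \<and> \<T> \<subseteq> nodes G - \<Omega>} \<noteq> {}" by blast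
  show ?thesis
    unfolding min_cut_def Min_ge_iff[OF fin ne] using assms(3) by blast
qed

lemma coded_network_to_ac:
  assumes "finite_extension_field (L :: 'f::{finite,field} alg_closure set)"
    and "is_network G" "acyclic_network G" "S \<in> nodes G"
  shows "coded_network L to_ac G S"
proof -
  have "finite L" and sub: "subfield L (ring_of_type_algebra :: 'f alg_closure ring)"
    and "\<And>a. to_ac a \<in> L"
    using assms(1) by (auto simp: finite_extension_field_def)
  then show ?thesis
    using assms(2-4) sub[unfolded subfield_type_algebra_iff] by unfold_locales simp_all
qed

theorem theorem9:
  fixes G :: "('v, 'p) network" and S :: 'v and T :: "nat \<Rightarrow> 'v"
    and K N \<mu> :: nat and D :: "nat \<Rightarrow> nat set"
    and \<C>\<^sub>d \<C>\<^sub>m :: "('v \<times> nat set) set"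
  assumes "is_network G" and "acyclic_network G"
    and "S \<in> nodes G" and "\<mu> \<le> card (outports G S)"
    and "T ` {1..N} \<subseteq> nodes G" and "inj_on T {1..N}" and "S \<notin> T ` {1..N}"
    and "K \<le> N"
    and "\<And>i. i \<in> {1..K} \<Longrightarrow> D i \<subseteq> {1..\<mu>}"
    and "\<And>i j. i \<in> {1..K} \<Longrightarrow> j \<in> {1..K} \<Longrightarrow> i \<noteq> j \<Longrightarrow> D i \<inter> D j = {}"
    and "\<C>\<^sub>d = {(T i, D i) | i. i \<in> {1..K}}"
    and "\<C>\<^sub>m = {(T i, {1..\<mu>}) | i. i \<in> {K+1..N}}"
  shows "solvable TYPE('f::{finite,field}) G S \<mu> (\<C>\<^sub>d \<union> \<C>\<^sub>m) \<longleftrightarrow>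
    (\<forall>\<T>. \<T> \<noteq> {} \<and> \<T> \<subseteq> T ` {1..K} \<longrightarrow>
        (\<Sum>i | i \<in> {1..K} \<and> T i \<in> \<T>. card (D i)) \<le> min_cut TYPE('f) G S \<T>) \<and>
    (\<forall>j \<in> {K+1..N}. \<mu> \<le> min_cut TYPE('f) G S {T j})"
proof -
  have sink: "T i \<in> nodes G - {S}" if "i \<in> {1..N}" for i using assms(5,7) that by auto
  have TK: "\<T> \<subseteq> nodes G" "S \<notin> \<T>" if "\<T> \<subseteq> T ` {1..K}" for \<T>
    using that sink assms(8) by force+
  have TN: "{T j} \<subseteq> nodes G" "S \<notin> {T j}" if "j \<in> {K+1..N}" for j
    using sink[of j] that by auto
  have min_cut_K: "n \<le> min_cut TYPE('f) G S \<T> \<longleftrightarrow>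
      (\<forall>\<Omega>. \<Omega> \<subseteq> nodes G \<longrightarrow> S \<in> \<Omega> \<longrightarrow> \<T> \<inter> \<Omega> = {} \<longrightarrow> n \<le> cut_rank TYPE('f) G \<Omega>)"
    if "\<T> \<subseteq> T ` {1..K}" for n \<T>
    by (rule le_min_cut_iff[OF assms(1,3) TK[OF that]])
  have min_cut_N: "n \<le> min_cut TYPE('f) G S {T j} \<longleftrightarrow>
      (\<forall>\<Omega>. \<Omega> \<subseteq> nodes G \<longrightarrow> S \<in> \<Omega> \<longrightarrow> {T j} \<inter> \<Omega> = {} \<longrightarrow> n \<le> cut_rank TYPE('f) G \<Omega>)"
    if "j \<in> {K+1..N}" for n j
    by (rule le_min_cut_iff[OF assms(1,3) TN[OF that]])
  show ?thesis
  proof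
    assume "solvable TYPE('f) G S \<mu> (\<C>\<^sub>d \<union> \<C>\<^sub>m)"
    then obtain L :: "'f alg_closure set" and \<alpha> \<beta> \<epsilon> \<nu> y where L: "finite_extension_field L"
      and code': "\<forall>i e. \<alpha> i e \<in> L" "\<forall>e' e. \<beta> e' e \<in> L" "\<forall>e' T k. \<epsilon> e' T k \<in> L"
        "\<forall>x \<in> {1..\<mu>} \<rightarrow>\<^sub>E L. transmission G S \<mu> \<alpha> \<beta> x (y x)"
      and dec: "\<forall>(T, D) \<in> \<C>\<^sub>d \<union> \<C>\<^sub>m. \<forall>j\<in>D. \<exists>k\<in>{1..\<nu> T}. \<forall>x \<in> {1..\<mu>} \<rightarrow>\<^sub>E L.
          received G \<epsilon> (y x) T k = x j"
      unfolding solvable_def by - (elim exE conjE, (rule that; assumption))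
    have code: "\<And>i e. \<alpha> i e \<in> L" "\<And>e' e. \<beta> e' e \<in> L"
        "\<And>x. x \<in> {1..\<mu>} \<rightarrow>\<^sub>E L \<Longrightarrow> transmission G S \<mu> \<alpha> \<beta> x (y x)"
      using code' by blast+
    interpret coded_network L to_ac G S \<mu>
      by (rule coded_network_to_ac[OF L assms(1-3)])
    \<comment> \<open>Both necessary conditions are instances: it suffices that each process of
      \<open>D'\<close> is demanded by some destination beyond the cut.\<close>
    have bound: "card D' \<le> cut_rank TYPE('f) G \<Omega>"
      if \<Omega>: "\<Omega> \<subseteq> nodes G" "S \<in> \<Omega>" "D' \<subseteq> {1..\<mu>}"
        and outside: "\<And>m. m \<in> D' \<Longrightarrow> \<exists>(V, B) \<in> \<C>\<^sub>d \<union> \<C>\<^sub>m. m \<in> B \<and> V \<in> nodes G - \<Omega>" for \<Omega> D'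
    proof (rule decodable_le_cut_rank[OF code \<Omega>])
      fix m assume "m \<in> D'"
      then obtain V B where "(V, B) \<in> \<C>\<^sub>d \<union> \<C>\<^sub>m" "m \<in> B" "V \<in> nodes G - \<Omega>" using outside by blast
      then show "\<exists>\<tau>\<in>nodes G - \<Omega>. \<exists>k. \<forall>x \<in> {1..\<mu>} \<rightarrow>\<^sub>E L. received G \<epsilon> (y x) \<tau> k = x m"
        using dec by blast
    qed
    show "(\<forall>\<T>. \<T> \<noteq> {} \<and> \<T> \<subseteq> T ` {1..K} \<longrightarrow>
        (\<Sum>i | i \<in> {1..K} \<and> T i \<in> \<T>. card (D i)) \<le> min_cut TYPE('f) G S \<T>) \<and>
      (\<forall>j \<in> {K+1..N}. \<mu> \<le> min_cut TYPE('f) G S {T j})"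
    proof (intro conjI allI impI ballI)
      fix \<T> assume \<T>: "\<T> \<noteq> {} \<and> \<T> \<subseteq> T ` {1..K}"
      let ?I = "{i. i \<in> {1..K} \<and> T i \<in> \<T>}"
      \<comment> \<open>Disjointness of the demands enters the necessity direction only here,
        turning the total demand into the size of one set of processes.\<close>
      have eq: "(\<Sum>i\<in>?I. card (D i)) = card (\<Union>i\<in>?I. D i)"
        by (rule card_UN_disjoint[symmetric])
          (use assms(9,10) in \<open>auto intro: finite_subset[OF _ finite_atLeastAtMost]\<close>)
      have "card (\<Union>i\<in>?I. D i) \<le> cut_rank TYPE('f) G \<Omega>"
        if "\<Omega> \<subseteq> nodes G" "S \<in> \<Omega>" "\<T> \<inter> \<Omega> = {}" for \<Omega>
      proof (rule bound[OF that(1,2)])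
        show "(\<Union>i\<in>?I. D i) \<subseteq> {1..\<mu>}" using assms(9) by blast
        fix m assume "m \<in> (\<Union>i\<in>?I. D i)"
        then obtain i where i: "i \<in> {1..K}" "T i \<in> \<T>" "m \<in> D i" by blast
        then have "(T i, D i) \<in> \<C>\<^sub>d \<union> \<C>\<^sub>m" using assms(11) by blast
        moreover have "T i \<in> nodes G - \<Omega>" using i that(3) sink[of i] assms(8) by auto
        ultimately show "\<exists>(V, B) \<in> \<C>\<^sub>d \<union> \<C>\<^sub>m. m \<in> B \<and> V \<in> nodes G - \<Omega>" using i(3) by blast
      qed
      then show "(\<Sum>i\<in>?I. card (D i)) \<le> min_cut TYPE('f) G S \<T>"
        unfolding min_cut_K[OF conjunct2[OF \<T>]] eq by blast
    next
      fix j assume j: "j \<in> {K+1..N}"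
      have "card {1..\<mu>} \<le> cut_rank TYPE('f) G \<Omega>"
        if "\<Omega> \<subseteq> nodes G" "S \<in> \<Omega>" "{T j} \<inter> \<Omega> = {}" for \<Omega>
      proof (rule bound[OF that(1,2) subset_refl])
        fix m assume "m \<in> {1..\<mu>}"
        moreover have "(T j, {1..\<mu>}) \<in> \<C>\<^sub>d \<union> \<C>\<^sub>m" using j assms(12) by blast
        moreover have "T j \<in> nodes G - \<Omega>" using TN[OF j] that(3) by auto
        ultimately show "\<exists>(V, B) \<in> \<C>\<^sub>d \<union> \<C>\<^sub>m. m \<in> B \<and> V \<in> nodes G - \<Omega>" by blast
      qed
      then show "\<mu> \<le> min_cut TYPE('f) G S {T j}" unfolding min_cut_N[OF j] by simp
    qed
  next
    assume cuts: "(\<forall>\<T>. \<T> \<noteq> {} \<and> \<T> \<subseteq> T ` {1..K} \<longrightarrow>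
        (\<Sum>i | i \<in> {1..K} \<and> T i \<in> \<T>. card (D i)) \<le> min_cut TYPE('f) G S \<T>) \<and>
      (\<forall>j \<in> {K+1..N}. \<mu> \<le> min_cut TYPE('f) G S {T j})"
    \<comment> \<open>The bound leaves room for \<open>N + 1\<close> requirements in the union
      bound: one joint requirement and one for each full multicast destination.\<close>
    obtain L :: "'f alg_closure set" where L: "finite_extension_field L"
      "(N + 1) * 2 ^ card (nodes G) + 1 < card L"
      using ex_finite_extension_field by blast
    interpret coded_network L to_ac G S \<mu>
      by (rule coded_network_to_ac[OF L(1) assms(1-3)])
    have "\<exists>\<alpha> \<beta> \<epsilon> y. (\<forall>i e. \<alpha> i e \<in> L) \<and> (\<forall>e' e. \<beta> e' e \<in> L) \<and> (\<forall>e' V k. \<epsilon> e' V k \<in> L) \<and>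
      (\<forall>x \<in> {1..\<mu>} \<rightarrow>\<^sub>E L. transmission G S \<mu> \<alpha> \<beta> x (y x)) \<and>
      (\<forall>i\<in>{1..K}. \<forall>m\<in>D i. \<exists>k\<in>{1..\<mu>}. \<forall>x \<in> {1..\<mu>} \<rightarrow>\<^sub>E L. received G \<epsilon> (y x) (T i) k = x m) \<and>
      (\<forall>i\<in>{K+1..N}. \<forall>m\<in>{1..\<mu>}. \<forall>x \<in> {1..\<mu>} \<rightarrow>\<^sub>E L. received G \<epsilon> (y x) (T i) m = x m)"
    proof (rule sufficient_cuts_imp_code[OF L(2) _ assms(6,8,9,10)])
      show "T ` {1..N} \<subseteq> nodes G - {S}" using sink by blast
      fix \<Omega> assume \<Omega>: "\<Omega> \<subseteq> nodes G" "S \<in> \<Omega>"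
      let ?\<T> = "T ` {1..K} - \<Omega>"
      show "(\<Sum>i | i \<in> {1..K} \<and> T i \<notin> \<Omega>. card (D i)) \<le> cut_rank TYPE('f) G \<Omega>"
      \<comment> \<open>The min-cut hypothesis concerns nonempty sets only; if no disjoint multicast
        destination lies beyond the cut, the demand sum is empty.\<close>
      proof (cases "?\<T> = {}")
        case True
        then have *: "{i. i \<in> {1..K} \<and> T i \<notin> \<Omega>} = {}" by blast
        show ?thesis unfolding * by simp
      next
        case False
        have eq: "{i. i \<in> {1..K} \<and> T i \<notin> \<Omega>} = {i. i \<in> {1..K} \<and> T i \<in> ?\<T>}" by blast
        have sub: "?\<T> \<subseteq> T ` {1..K}" by blast
        have "(\<Sum>i | i \<in> {1..K} \<and> T i \<in> ?\<T>. card (D i)) \<le> min_cut TYPE('f) G S ?\<T>"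
          by (rule conjunct1[OF cuts, rule_format], rule conjI[OF False sub])
        from this[unfolded min_cut_K[OF sub]] \<Omega> show ?thesis unfolding eq by blast
      qed
    next
      fix j \<Omega> assume j: "j \<in> {K+1..N}" and \<Omega>: "\<Omega> \<subseteq> nodes G" "S \<in> \<Omega>" "T j \<notin> \<Omega>"
      from bspec[OF conjunct2[OF cuts] j, unfolded min_cut_N[OF j]] \<Omega>
      show "\<mu> \<le> cut_rank TYPE('f) G \<Omega>" by blast
    qed
    then obtain \<alpha> \<beta> \<epsilon> y where code: "\<forall>i e. \<alpha> i e \<in> L" "\<forall>e' e. \<beta> e' e \<in> L" "\<forall>e' V k. \<epsilon> e' V k \<in> L"
      "\<forall>x \<in> {1..\<mu>} \<rightarrow>\<^sub>E L. transmission G S \<mu> \<alpha> \<beta> x (y x)"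
      and dec: "\<forall>i\<in>{1..K}. \<forall>m\<in>D i. \<exists>k\<in>{1..\<mu>}. \<forall>x \<in> {1..\<mu>} \<rightarrow>\<^sub>E L. received G \<epsilon> (y x) (T i) k = x m"
        "\<forall>i\<in>{K+1..N}. \<forall>m\<in>{1..\<mu>}. \<forall>x \<in> {1..\<mu>} \<rightarrow>\<^sub>E L. received G \<epsilon> (y x) (T i) m = x m"
      by - (elim exE conjE, (rule that; assumption))
    have dec': "\<forall>(T, D) \<in> \<C>\<^sub>d \<union> \<C>\<^sub>m. \<forall>j\<in>D. \<exists>k\<in>{1..\<mu>}. \<forall>x \<in> {1..\<mu>} \<rightarrow>\<^sub>E L.
        received G \<epsilon> (y x) T k = x j"
      using dec unfolding assms(11,12) by blast
    \<comment> \<open>Every destination forms \<open>\<mu>\<close> components, enough for each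
      demand because all demands are subsets of \<open>{1..\<mu>}\<close>.\<close>
    show "solvable TYPE('f) G S \<mu> (\<C>\<^sub>d \<union> \<C>\<^sub>m)"
      unfolding solvable_def
      by (intro exI[of _ L] conjI exI[of _ \<alpha>] exI[of _ \<beta>] exI[of _ \<epsilon>] exI[of _ "\<lambda>_. \<mu>"] exI[of _ y],
        insert L(1) code dec') assumption+
  qed
qed

end
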